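(* A spray $\mathbf{G}$ on a manifold $M$ is projectively metrizable if and only if it has a Finsler-Hamel function $\bar F$. In this case, the spray $\mathbf{G}$ is projectively induced by the Finsler metric $\bar F$ (i.e. the spray of $\bar F$ is projectively related to $\mathbf{G}$), and the spray of $\bar F$ is the Hamel spray associated to $(\mathbf{G},\bar F)$.
   Context: A conical region $\mathcal{C}$ of $TM\setminus\{0\}$ is an open set such that each $\mathcal{C}_x=\mathcal{C}\cap (T_xM\setminus\{0\})$ is closed under $y\mapsto\lambda y$, $\lambda>0$. A spray on $M$ is a smooth vector field on a conical region, locally $\mathbf{G}=y^i\frac{\partial}{\partial x^i}-2G^i\frac{\partial}{\partial y^i}$ with $G^i$ positively homogeneous of degree two in $y$. Put $\partial_k=\partial/\partial x^k$, $\dot\partial_k=\partial/\partial y^k$, $G^r_i=\dot\partial_iG^r$, $G^r_{ij}=\dot\partial_j\dot\partial_iG^r$, $\delta_i=\partial_i-G^r_i\dot\partial_r$. For a function $f$: $f_{.i}=\dot\partial_if$, $f_{;i}=\delta_if$, $f_{;0}=f_{;i}y^i$, $f_{.i;j}=\delta_jf_{.i}-f_{.r}G^r_{ij}$, $f_{.i;0}=f_{.i;j}y^j$. Two sprays are projectively related if $\bar G^i=G^i+Py^i$ for some positively homogeneous function $P$ of degree one in $y$. A Finsler metric on $M$ is a $C^\infty$ function $L\ne0$ on a conical region, positively homogeneous of degree two in $y$, with $g_{ij}=(\frac12L)_{y^iy^j}$ nondegenerate. If $L=F^2>0$, $F$ (homogeneous of degree one) is also called a Finsler metric. It induces the spray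 $G^i=\frac14g^{il}\{L_{x^ky^l}y^k-L_{x^l}\}$. A spray $\mathbf{G}$ is projectively metrizable if there is a Finsler metric whose spray is projectively related to $\mathbf{G}$. A Hamel function of $\mathbf{G}$ is a function $Q$, positively homogeneous of degree one in $y$, with $Q_{;k}=Q_{.k;0}$. A Finsler-Hamel function of $\mathbf G$ is a Hamel function of $\mathbf G$ which is also a Finsler metric. For a (nonzero) Hamel function $Q$ of $\mathbf{G}$, the Hamel spray associated to $(\mathbf{G},Q)$ is the spray $\bar G^i:=G^i+\frac{Q_{;0}}{2Q}y^i$. *)

theory Defs
  imports "HOL-Analysis.Analysis"
begin

section \<open>Smooth maps between Euclidean spaces\<close>

primrec Ck_on :: "nat \<Rightarrow> 'a::real_normed_vector set \<Rightarrow> ('a \<Rightarrow> 'b::real_normed_vector) \<Rightarrow> bool" where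
  "Ck_on 0 S f \<longleftrightarrow> continuous_on S f"
| "Ck_on (Suc k) S f \<longleftrightarrow>
     (\<forall>x\<in>S. f differentiable (at x)) \<and> (\<forall>v. Ck_on k S (\<lambda>x. frechet_derivative f (at x) v))"

text \<open>Only used for open \<open>S\<close>.\<close>
definition smooth_on :: "'a::real_normed_vector set \<Rightarrow> ('a \<Rightarrow> 'b::real_normed_vector) \<Rightarrow> bool" where
  "smooth_on S f \<longleftrightarrow> (\<forall>k. Ck_on k S f)"


section \<open>Smooth manifolds given by an atlas\<close>

text \<open>A chart is a pair of a domain and a coordinate map; the values of the coordinate map
  outside the domain are irrelevant.\<close>
type_synonym ('p, 'e) chart = "'p set \<times> ('p \<Rightarrow> 'e)"

definition chart_inv :: "('p, 'e) chart \<Rightarrow> 'e \<Rightarrow> 'p" where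
  "chart_inv c = inv_into (fst c) (snd c)"

definition chart_image :: "'p set \<Rightarrow> ('p, 'e) chart \<Rightarrow> 'e set" where
  "chart_image S c = snd c ` (S \<inter> fst c)"

definition transition :: "('p, 'e) chart \<Rightarrow> ('p, 'e) chart \<Rightarrow> 'e \<Rightarrow> 'e" where
  "transition c d = snd d \<circ> chart_inv c"

definition smooth_atlas :: "'p set \<Rightarrow> ('p, 'e::euclidean_space) chart set \<Rightarrow> bool" where
  "smooth_atlas M A \<longleftrightarrow>
     (\<Union>c\<in>A. fst c) = M \<and>
     (\<forall>c\<in>A. inj_on (snd c) (fst c) \<and> open (snd c ` fst c)) \<and>
     (\<forall>c\<in>A. \<forall>d\<in>A. open (chart_image (fst d) c) \<and>
        smooth_on (chart_image (fst d) c) (transition c d))"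

definition atlas_topology :: "'p set \<Rightarrow> ('p, 'e::euclidean_space) chart set \<Rightarrow> 'p topology" where
  "atlas_topology M A = topology (\<lambda>S. S \<subseteq> M \<and> (\<forall>c\<in>A. open (chart_image S c)))"

lemma openin_atlas_topology:
  assumes inj: "\<And>c. c \<in> A \<Longrightarrow> inj_on (snd c) (fst c)"
  shows "openin (atlas_topology M A) S \<longleftrightarrow> S \<subseteq> M \<and> (\<forall>c\<in>A. open (chart_image S c))"
proof -
  have "istopology (\<lambda>S. S \<subseteq> M \<and> (\<forall>c\<in>A. open (chart_image S c)))"
    unfolding istopology_def
  proof (intro conjI allI impI)
    fix S T
    assume S: "S \<subseteq> M \<and> (\<forall>c\<in>A. open (chart_image S c))"
      and T: "T \<subseteq> M \<and> (\<forall>c\<in>A. open (chart_image T c))"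
    show "S \<inter> T \<subseteq> M" using S by blast
    show "\<forall>c\<in>A. open (chart_image (S \<inter> T) c)"
    proof
      fix c assume c: "c \<in> A"
      have "chart_image (S \<inter> T) c = chart_image S c \<inter> chart_image T c"
        using inj[OF c] unfolding chart_image_def inj_on_def by blast
      then show "open (chart_image (S \<inter> T) c)" using S T c by auto
    qed
  next
    fix K assume K: "\<forall>S\<in>K. S \<subseteq> M \<and> (\<forall>c\<in>A. open (chart_image S c))"
    show "\<Union>K \<subseteq> M" using K by blast
    show "\<forall>c\<in>A. open (chart_image (\<Union>K) c)"
    proof
      fix c assume c: "c \<in> A"
      have "chart_image (\<Union>K) c = (\<Union>S\<in>K. chart_image S c)"
        unfolding chart_image_def by blast
      then show "open (chart_image (\<Union>K) c)" using K c by auto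
    qed
  qed
  then show ?thesis
    unfolding atlas_topology_def by (simp add: topology_inverse')
qed

definition smooth_manifold :: "'p set \<Rightarrow> ('p, 'e::euclidean_space) chart set \<Rightarrow> bool" where
  "smooth_manifold M A \<longleftrightarrow> smooth_atlas M A \<and>
     Hausdorff_space (atlas_topology M A) \<and> second_countable (atlas_topology M A)"

text \<open>Smoothness of a real function on an open subset \<open>S\<close> of the manifold with atlas \<open>A\<close>.\<close>
definition smooth_fun :: "('p, 'e::euclidean_space) chart set \<Rightarrow> 'p set \<Rightarrow> ('p \<Rightarrow> real) \<Rightarrow> bool" where
  "smooth_fun A S f \<longleftrightarrow> (\<forall>c\<in>A. smooth_on (chart_image S c) (f \<circ> chart_inv c))"


section \<open>The tangent bundle and vector fields\<close>

text \<open>A tangent vector at \<open>p\<close> is the family of its components with respect to all charts around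
  \<open>p\<close>, related by the differentials of the transition maps. The components with respect to
  other charts are set to \<open>0\<close>, so that equality of families is equality of vectors.\<close>
type_synonym ('p, 'e) tvec = "('p, 'e) chart \<Rightarrow> 'e"

definition tangent_space :: "('p, 'e::euclidean_space) chart set \<Rightarrow> 'p \<Rightarrow> ('p, 'e) tvec set" where
  "tangent_space A p =
     {\<xi>. (\<forall>c. c \<notin> A \<or> p \<notin> fst c \<longrightarrow> \<xi> c = 0) \<and>
         (\<forall>c\<in>A. \<forall>d\<in>A. p \<in> fst c \<and> p \<in> fst d \<longrightarrow>
            \<xi> d = frechet_derivative (transition c d) (at (snd c p)) (\<xi> c))}"

definition tangent_bundle ::
  "'p set \<Rightarrow> ('p, 'e::euclidean_space) chart set \<Rightarrow> ('p \<times> ('p, 'e) tvec) set" where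
  "tangent_bundle M A = (SIGMA p:M. tangent_space A p)"

definition tangent_chart ::
  "'p set \<Rightarrow> ('p, 'e::euclidean_space) chart set \<Rightarrow> ('p, 'e) chart
    \<Rightarrow> ('p \<times> ('p, 'e) tvec, 'e \<times> 'e) chart" where
  "tangent_chart M A c =
     ({q \<in> tangent_bundle M A. fst q \<in> fst c}, \<lambda>q. (snd c (fst q), snd q c))"

definition tangent_atlas ::
  "'p set \<Rightarrow> ('p, 'e::euclidean_space) chart set
    \<Rightarrow> ('p \<times> ('p, 'e) tvec, 'e \<times> 'e) chart set" where
  "tangent_atlas M A = tangent_chart M A ` A"

definition smooth_vector_field ::
  "('p, 'e::euclidean_space) chart set \<Rightarrow> 'p set \<Rightarrow> ('p \<Rightarrow> ('p, 'e) tvec) \<Rightarrow> bool" where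
  "smooth_vector_field A S X \<longleftrightarrow>
     (\<forall>p\<in>S. X p \<in> tangent_space A p) \<and>
     (\<forall>c\<in>A. smooth_on (chart_image S c) (\<lambda>z. X (chart_inv c z) c))"


section \<open>Conical regions and homogeneous functions\<close>

definition scale_vec ::
  "real \<Rightarrow> 'p \<times> ('p, 'e::real_vector) tvec \<Rightarrow> 'p \<times> ('p, 'e) tvec" where
  "scale_vec t q = (fst q, \<lambda>c. t *\<^sub>R snd q c)"

definition conical_region ::
  "'p set \<Rightarrow> ('p, 'e::euclidean_space) chart set \<Rightarrow> ('p \<times> ('p, 'e) tvec) set \<Rightarrow> bool" where
  "conical_region M A C \<longleftrightarrow>
     openin (atlas_topology (tangent_bundle M A) (tangent_atlas M A)) C \<and>
     (\<forall>q\<in>C. snd q \<noteq> (\<lambda>c. 0)) \<and>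
     (\<forall>q\<in>C. \<forall>t>0. scale_vec t q \<in> C)"

definition pos_homogeneous ::
  "nat \<Rightarrow> ('p \<times> ('p, 'e::euclidean_space) tvec) set \<Rightarrow> ('p \<times> ('p, 'e) tvec \<Rightarrow> real) \<Rightarrow> bool" where
  "pos_homogeneous m C f \<longleftrightarrow> (\<forall>q\<in>C. \<forall>t>0. f (scale_vec t q) = t ^ m * f q)"


section \<open>Local coordinate formulas\<close>

text \<open>Local functions depend on \<open>z = (x, y)\<close>. Below \<open>G\<close> denotes the vector of local spray
  coefficients.\<close>

definition dx :: "'n::finite \<Rightarrow> ((real^'n) \<times> (real^'n) \<Rightarrow> real) \<Rightarrow> (real^'n) \<times> (real^'n) \<Rightarrow> real" where
  "dx k f z = frechet_derivative f (at z) (axis k 1, 0)"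

definition dy :: "'n::finite \<Rightarrow> ((real^'n) \<times> (real^'n) \<Rightarrow> real) \<Rightarrow> (real^'n) \<times> (real^'n) \<Rightarrow> real" where
  "dy k f z = frechet_derivative f (at z) (0, axis k 1)"

type_synonym 'n coeffs = "(real^'n) \<times> (real^'n) \<Rightarrow> real^'n"

text \<open>\<open>conn1 G r i\<close> is \<open>G\<^sup>r\<^sub>i\<close> and \<open>conn2 G r i j\<close> is \<open>G\<^sup>r\<^sub>i\<^sub>j\<close>.\<close>

definition conn1 :: "'n::finite coeffs \<Rightarrow> 'n \<Rightarrow> 'n \<Rightarrow> (real^'n) \<times> (real^'n) \<Rightarrow> real" where
  "conn1 G r i = dy i (\<lambda>z. G z $ r)"

definition conn2 :: "'n::finite coeffs \<Rightarrow> 'n \<Rightarrow> 'n \<Rightarrow> 'n \<Rightarrow> (real^'n) \<times> (real^'n) \<Rightarrow> real" where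
  "conn2 G r i j = dy j (conn1 G r i)"

text \<open>The horizontal derivative \<open>f\<^sub>;\<^sub>i = \<delta>\<^sub>i f\<close>.\<close>
definition hder ::
  "'n::finite coeffs \<Rightarrow> 'n \<Rightarrow> ((real^'n) \<times> (real^'n) \<Rightarrow> real) \<Rightarrow> (real^'n) \<times> (real^'n) \<Rightarrow> real" where
  "hder G i f z = dx i f z - (\<Sum>r\<in>UNIV. conn1 G r i z * dy r f z)"

text \<open>\<open>f\<^sub>;\<^sub>0\<close>\<close>
definition hder0 ::
  "'n::finite coeffs \<Rightarrow> ((real^'n) \<times> (real^'n) \<Rightarrow> real) \<Rightarrow> (real^'n) \<times> (real^'n) \<Rightarrow> real" where
  "hder0 G f z = (\<Sum>i\<in>UNIV. hder G i f z * snd z $ i)"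

text \<open>\<open>f\<^sub>.\<^sub>i\<^sub>;\<^sub>j\<close>\<close>
definition vhder ::
  "'n::finite coeffs \<Rightarrow> 'n \<Rightarrow> 'n \<Rightarrow> ((real^'n) \<times> (real^'n) \<Rightarrow> real) \<Rightarrow> (real^'n) \<times> (real^'n) \<Rightarrow> real" where
  "vhder G i j f z = hder G j (dy i f) z - (\<Sum>r\<in>UNIV. dy r f z * conn2 G r i j z)"

text \<open>\<open>f\<^sub>.\<^sub>i\<^sub>;\<^sub>0\<close>\<close>
definition vhder0 ::
  "'n::finite coeffs \<Rightarrow> 'n \<Rightarrow> ((real^'n) \<times> (real^'n) \<Rightarrow> real) \<Rightarrow> (real^'n) \<times> (real^'n) \<Rightarrow> real" where
  "vhder0 G i f z = (\<Sum>j\<in>UNIV. vhder G i j f z * snd z $ j)"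

definition fundamental_tensor ::
  "((real^'n) \<times> (real^'n) \<Rightarrow> real) \<Rightarrow> (real^'n) \<times> (real^'n) \<Rightarrow> real^'n^'n::finite" where
  "fundamental_tensor L z = (\<chi> i j. dy j (dy i (\<lambda>w. 1/2 * L w)) z)"

definition finsler_coeffs :: "((real^'n) \<times> (real^'n) \<Rightarrow> real) \<Rightarrow> 'n::finite coeffs" where
  "finsler_coeffs L z =
     (\<chi> i. 1/4 * (\<Sum>l\<in>UNIV. matrix_inv (fundamental_tensor L z) $ i $ l *
              ((\<Sum>k\<in>UNIV. dy l (dx k L) z * snd z $ k) - dx l L z)))"


section \<open>Sprays\<close>

type_synonym ('m, 'n) tpoint = "'m \<times> ('m, real^'n) tvec"
type_synonym ('m, 'n) tchart = "(('m, 'n) tpoint, (real^'n) \<times> (real^'n)) chart"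
type_synonym ('m, 'n) tfield = "('m, 'n) tpoint \<Rightarrow> (('m, 'n) tpoint, (real^'n) \<times> (real^'n)) tvec"

text \<open>The local coefficients of a vector field of the form
  \<open>y\<^sup>i \<partial>/\<partial>x\<^sup>i - 2 G\<^sup>i \<partial>/\<partial>y\<^sup>i\<close> on the tangent bundle, and conversely the
  field with prescribed local coefficients.\<close>

definition spray_coeffs :: "('m, 'n::finite) tfield \<Rightarrow> ('m, 'n) tchart \<Rightarrow> 'n coeffs" where
  "spray_coeffs G c z = (- 1/2) *\<^sub>R snd (G (chart_inv c z) c)"

definition field_of_coeffs ::
  "('m, 'n) tchart set \<Rightarrow> (('m, 'n) tchart \<Rightarrow> 'n::finite coeffs) \<Rightarrow> ('m, 'n) tfield" where
  "field_of_coeffs B K q c =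
     (if c \<in> B \<and> q \<in> fst c then (snd (snd c q), (- 2) *\<^sub>R K c (snd c q)) else 0)"

definition spray ::
  "'m set \<Rightarrow> ('m, real^'n::finite) chart set \<Rightarrow> ('m, 'n) tpoint set \<Rightarrow> ('m, 'n) tfield \<Rightarrow> bool" where
  "spray M A C G \<longleftrightarrow>
     conical_region M A C \<and>
     smooth_vector_field (tangent_atlas M A) C G \<and>
     (\<forall>c\<in>tangent_atlas M A. \<forall>z\<in>chart_image C c.
        fst (G (chart_inv c z) c) = snd z \<and>
        (\<forall>t>0. spray_coeffs G c (fst z, t *\<^sub>R snd z) = t\<^sup>2 *\<^sub>R spray_coeffs G c z))"

definition projectively_related ::
  "'m set \<Rightarrow> ('m, real^'n::finite) chart set \<Rightarrow> ('m, 'n) tpoint set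
    \<Rightarrow> ('m, 'n) tfield \<Rightarrow> ('m, 'n) tfield \<Rightarrow> bool" where
  "projectively_related M A C G H \<longleftrightarrow>
     spray M A C G \<and> spray M A C H \<and>
     (\<exists>P. pos_homogeneous 1 C P \<and>
        (\<forall>c\<in>tangent_atlas M A. \<forall>z\<in>chart_image C c.
           spray_coeffs H c z = spray_coeffs G c z + P (chart_inv c z) *\<^sub>R snd z))"


section \<open>Finsler metrics\<close>

definition finsler_metric ::
  "'m set \<Rightarrow> ('m, real^'n::finite) chart set \<Rightarrow> ('m, 'n) tpoint set
    \<Rightarrow> (('m, 'n) tpoint \<Rightarrow> real) \<Rightarrow> bool" where
  "finsler_metric M A C L \<longleftrightarrow>
     conical_region M A C \<and>
     smooth_fun (tangent_atlas M A) C L \<and>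
     (\<forall>q\<in>C. L q \<noteq> 0) \<and>
     pos_homogeneous 2 C L \<and>
     (\<forall>c\<in>tangent_atlas M A. \<forall>z\<in>chart_image C c.
        invertible (fundamental_tensor (L \<circ> chart_inv c) z))"

text \<open>Finsler metrics in the degree one convention, that is \<open>L = F\<^sup>2 > 0\<close>.\<close>
definition finsler_metric1 ::
  "'m set \<Rightarrow> ('m, real^'n::finite) chart set \<Rightarrow> ('m, 'n) tpoint set
    \<Rightarrow> (('m, 'n) tpoint \<Rightarrow> real) \<Rightarrow> bool" where
  "finsler_metric1 M A C F \<longleftrightarrow>
     smooth_fun (tangent_atlas M A) C F \<and>
     pos_homogeneous 1 C F \<and>
     finsler_metric M A C (\<lambda>q. (F q)\<^sup>2)"

text \<open>The spray induced by a metric \<open>L\<close> of degree two.\<close>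
definition finsler_spray ::
  "'m set \<Rightarrow> ('m, real^'n::finite) chart set \<Rightarrow> (('m, 'n) tpoint \<Rightarrow> real) \<Rightarrow> ('m, 'n) tfield" where
  "finsler_spray M A L =
     field_of_coeffs (tangent_atlas M A) (\<lambda>c. finsler_coeffs (L \<circ> chart_inv c))"

definition projectively_metrizable ::
  "'m set \<Rightarrow> ('m, real^'n::finite) chart set \<Rightarrow> ('m, 'n) tpoint set \<Rightarrow> ('m, 'n) tfield \<Rightarrow> bool" where
  "projectively_metrizable M A C G \<longleftrightarrow>
     (\<exists>L. finsler_metric M A C L \<and> projectively_related M A C G (finsler_spray M A L))"


section \<open>Hamel functions\<close>

definition hamel_function ::
  "'m set \<Rightarrow> ('m, real^'n::finite) chart set \<Rightarrow> ('m, 'n) tpoint set \<Rightarrow> ('m, 'n) tfield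
    \<Rightarrow> (('m, 'n) tpoint \<Rightarrow> real) \<Rightarrow> bool" where
  "hamel_function M A C G Q \<longleftrightarrow>
     smooth_fun (tangent_atlas M A) C Q \<and>
     pos_homogeneous 1 C Q \<and>
     (\<forall>c\<in>tangent_atlas M A. \<forall>z\<in>chart_image C c. \<forall>k.
        hder (spray_coeffs G c) k (Q \<circ> chart_inv c) z =
        vhder0 (spray_coeffs G c) k (Q \<circ> chart_inv c) z)"

definition finsler_hamel_function ::
  "'m set \<Rightarrow> ('m, real^'n::finite) chart set \<Rightarrow> ('m, 'n) tpoint set \<Rightarrow> ('m, 'n) tfield
    \<Rightarrow> (('m, 'n) tpoint \<Rightarrow> real) \<Rightarrow> bool" where
  "finsler_hamel_function M A C G F \<longleftrightarrow> hamel_function M A C G F \<and> finsler_metric1 M A C F"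

definition hamel_spray ::
  "'m set \<Rightarrow> ('m, real^'n::finite) chart set \<Rightarrow> ('m, 'n) tfield
    \<Rightarrow> (('m, 'n) tpoint \<Rightarrow> real) \<Rightarrow> ('m, 'n) tfield" where
  "hamel_spray M A G Q =
     field_of_coeffs (tangent_atlas M A)
       (\<lambda>c z. spray_coeffs G c z +
          (hder0 (spray_coeffs G c) (Q \<circ> chart_inv c) z / (2 * Q (chart_inv c z))) *\<^sub>R snd z)"

end

theory Submission
  imports Defs
begin

text \<open>
  In coordinates write \<open>S\<^sub>G = y\<^sup>j \<partial>\<^sub>j - 2 G\<^sup>r \<partial>/\<partial>y\<^sup>r\<close> for the spray as a derivation. The proof
  rests on one reformulation: for a function \<open>F\<close> that is homogeneous of degree one, Hamel's equation
  \<open>F\<^sub>;\<^sub>k = F\<^sub>.\<^sub>k\<^sub>;\<^sub>0\<close> is the Euler-Lagrange equation \<open>S\<^sub>G (F\<^sub>.\<^sub>k) = \<partial>\<^sub>k F\<close>, because Euler's theorem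
  removes the connection coefficients (\<open>hamel_equation_iff\<close>). Three facts about this equation then
  give everything.

  \<^item> It is projectively invariant. Replacing \<open>G\<close> by \<open>G + P y\<close> changes \<open>S\<^sub>G (F\<^sub>.\<^sub>k)\<close> by a multiple of
    \<open>F\<^sub>.\<^sub>k\<^sub>.\<^sub>r y\<^sup>r\<close>, which vanishes since \<open>F\<^sub>.\<^sub>k\<close> has degree zero (\<open>euler_lagrange_projective\<close>).

  \<^item> A metric \<open>L\<close> of degree two satisfies the Euler-Lagrange equation for \<open>G\<close> at a point exactly
    when \<open>G\<close> is the spray of \<open>L\<close> there: the equation is a linear system for \<open>G\<close> with matrix
    \<open>g\<^sub>i\<^sub>j\<close> (\<open>euler_lagrange_iff_finsler_coeffs\<close>).

  \<^item> If \<open>L = c F\<^sup>2\<close>, the equation for \<open>L\<close> is equivalent to the equation for \<open>F\<close> together with the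
    energy condition \<open>S\<^sub>G F = 0\<close> (\<open>euler_lagrange_square_iff\<close>).

  If \<open>G\<close> is projectively related to the spray of \<open>L\<close>, then locally \<open>L = \<plusminus>F\<^sup>2\<close> with
  \<open>F = \<surd>\<bar>L\<bar>\<close>, so \<open>F\<close> satisfies the Euler-Lagrange equation for the spray of \<open>L\<close>, hence for \<open>G\<close>,
  and is a Finsler-Hamel function (\<open>finsler_hamel_function_sqrt_metric\<close>). Conversely, for a
  Finsler-Hamel function \<open>F\<close> the Euler-Lagrange equation holds for every \<open>G + P y\<close>, and
  \<open>P = S\<^sub>G F / (2 F)\<close> is the choice with \<open>S F = 0\<close>. So \<open>G + P y\<close> is the spray of \<open>F\<^sup>2\<close>, and it is the
  Hamel spray by definition (\<open>finsler_spray_eq_hamel_spray\<close>).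

  Globally, the Hamel spray has to be a vector field on the conical region. It is the vector field
  \<open>G\<close> plus a multiple of the Liouville field \<open>y\<^sup>i \<partial>/\<partial>y\<^sup>i\<close>. The factor is chart independent because
  \<open>S\<^sub>G F\<close> is the derivative of \<open>F\<close> along \<open>G\<close>, and the Liouville field is preserved by the linear action
  of coordinate changes on fibres (\<open>hamel_spray_projectively_related\<close>).
\<close>

section \<open>Calculus of smooth functions\<close>

lemma Ck_on_subset: "Ck_on k S f \<Longrightarrow> T \<subseteq> S \<Longrightarrow> Ck_on k T f"
  by (induction k arbitrary: f) (auto intro: continuous_on_subset)

lemma Ck_on_cong:
  assumes "open S" and "\<And>x. x \<in> S \<Longrightarrow> f x = g x" and "Ck_on k S f"
  shows "Ck_on k S g"
  using assms(2,3)
proof (induction k arbitrary: f g)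
  case 0
  then show ?case using continuous_on_cong[of S S f g] by simp
next
  case (Suc k)
  have D: "(g has_derivative frechet_derivative f (at x)) (at x)" if "x \<in> S" for x
    by (rule has_derivative_transform_within_open[of f _ _ _ S])
      (use that Suc.prems assms(1) in \<open>auto simp: frechet_derivative_works\<close>)
  have "Ck_on k S (\<lambda>x. frechet_derivative g (at x) v)" for v
  proof (rule Suc.IH)
    show "frechet_derivative f (at x) v = frechet_derivative g (at x) v" if "x \<in> S" for x
      using frechet_derivative_at[OF D[OF that]] by simp
    show "Ck_on k S (\<lambda>x. frechet_derivative f (at x) v)" using Suc.prems by simp
  qed
  then show ?case using D by (auto simp: differentiable_def)
qed

lemma Ck_on_SucI:
  assumes "open S" and D: "\<And>x. x \<in> S \<Longrightarrow> (f has_derivative f' x) (at x)"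
    and "\<And>v. Ck_on k S (\<lambda>x. f' x v)"
  shows "Ck_on (Suc k) S f"
proof -
  have "Ck_on k S (\<lambda>x. frechet_derivative f (at x) v)" for v
    by (rule Ck_on_cong[OF assms(1) _ assms(3)[of v]])
      (simp add: frechet_derivative_at[OF D, symmetric])
  then show ?thesis using D by (auto simp: differentiable_def)
qed

lemma Ck_on_SucD: "Ck_on (Suc k) S f \<Longrightarrow> Ck_on k S f"
proof (induction k arbitrary: f)
  case 0
  then show ?case
    using differentiable_at_withinI differentiable_imp_continuous_on
    by (metis Ck_on.simps differentiable_on_def)
next
  case (Suc k)
  then show ?case by (auto simp: Suc.IH)
qed

lemma Ck_on_has_derivative:
  "Ck_on (Suc k) S f \<Longrightarrow> x \<in> S \<Longrightarrow> (f has_derivative frechet_derivative f (at x)) (at x)"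
  by (simp add: frechet_derivative_works)

lemma Ck_on_const: "open S \<Longrightarrow> Ck_on k S (\<lambda>x. c)"
proof (induction k arbitrary: c)
  case (Suc k)
  show ?case by (rule Ck_on_SucI[where f' = "\<lambda>_ _. 0"]) (use Suc in auto)
qed simp

lemma Ck_on_bounded_linear:
  assumes "bounded_linear L" "open S" "Ck_on k S f"
  shows "Ck_on k S (\<lambda>x. L (f x))"
  using assms(3)
proof (induction k arbitrary: f)
  case 0
  then show ?case using bounded_linear.continuous_on[OF assms(1)] by simp
next
  case (Suc k)
  show ?case
    by (rule Ck_on_SucI[OF assms(2),
          where f' = "\<lambda>x v. L (frechet_derivative f (at x) v)"])
      (use Suc bounded_linear.has_derivative[OF assms(1) Ck_on_has_derivative[OF Suc.prems]] in auto)
qed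

lemma Ck_on_add:
  assumes "open S" "Ck_on k S f" "Ck_on k S g"
  shows "Ck_on k S (\<lambda>x. f x + g x)"
  using assms(2,3)
proof (induction k arbitrary: f g)
  case 0
  then show ?case by (auto intro: continuous_intros)
next
  case (Suc k)
  show ?case
    by (rule Ck_on_SucI[OF assms(1),
          where f' = "\<lambda>x v. frechet_derivative f (at x) v + frechet_derivative g (at x) v"])
      (use Suc Ck_on_has_derivative in \<open>auto intro!: derivative_intros simp: frechet_derivative_works\<close>)
qed

lemma Ck_on_sum:
  assumes "open S" "finite I" "\<And>i. i \<in> I \<Longrightarrow> Ck_on k S (f i)"
  shows "Ck_on k S (\<lambda>x. \<Sum>i\<in>I. f i x)"
  using assms(2,3)
  by (induction I) (auto intro!: Ck_on_add Ck_on_const assms(1))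

lemma Ck_on_bounded_bilinear:
  assumes "bounded_bilinear B" "open S" "Ck_on k S f" "Ck_on k S g"
  shows "Ck_on k S (\<lambda>x. B (f x) (g x))"
  using assms(3,4)
proof (induction k arbitrary: f g)
  case 0
  then show ?case using bounded_bilinear.continuous_on[OF assms(1)] by simp
next
  case (Suc k)
  note low = Suc.prems[THEN Ck_on_SucD]
  show ?case
  proof (rule Ck_on_SucI[OF assms(2)])
    show "((\<lambda>x. B (f x) (g x)) has_derivative (\<lambda>v. B (f x) (frechet_derivative g (at x) v) +
        B (frechet_derivative f (at x) v) (g x))) (at x)" if "x \<in> S" for x
      by (rule bounded_bilinear.FDERIV[OF assms(1)])
        (use Suc.prems that Ck_on_has_derivative in blast)+
    show "Ck_on k S (\<lambda>x. B (f x) (frechet_derivative g (at x) v) +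
        B (frechet_derivative f (at x) v) (g x))" for v
      by (intro Ck_on_add Suc.IH assms(2) low) (use Suc.prems in auto)
  qed
qed

lemmas Ck_on_mult = Ck_on_bounded_bilinear[OF bounded_bilinear_mult]
lemmas Ck_on_scaleR = Ck_on_bounded_bilinear[OF bounded_bilinear_scaleR]

lemma Ck_on_ident: "open S \<Longrightarrow> Ck_on k S (\<lambda>x. x)"
proof (cases k)
  case (Suc j)
  assume "open S"
  then show ?thesis unfolding Suc
    by (intro Ck_on_SucI[where f' = "\<lambda>_ v. v"] Ck_on_const) auto
qed simp

lemma Ck_on_Pair:
  assumes "open S" "Ck_on k S f" "Ck_on k S g"
  shows "Ck_on k S (\<lambda>x. (f x, g x))"
proof -
  have "Ck_on k S (\<lambda>x. (f x, 0) + (0, g x))"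
    by (intro Ck_on_add assms Ck_on_bounded_linear[of "\<lambda>u. (u, 0)"]
        Ck_on_bounded_linear[of "\<lambda>u. (0, u)"] bounded_linear_Pair bounded_linear_zero
        bounded_linear_ident)
  then show ?thesis by simp
qed

lemma Ck_on_inverse:
  fixes f :: "'a::real_normed_vector \<Rightarrow> real"
  assumes "open S" "Ck_on k S f" "\<And>x. x \<in> S \<Longrightarrow> f x \<noteq> 0"
  shows "Ck_on k S (\<lambda>x. inverse (f x))"
  using assms(2)
proof (induction k)
  case 0
  then show ?case using assms(3) by (auto intro: continuous_intros)
next
  case (Suc k)
  note IH = Suc.IH[OF Ck_on_SucD[OF Suc.prems]]
  show ?case
  proof (rule Ck_on_SucI[OF assms(1)])
    show "((\<lambda>x. inverse (f x)) has_derivative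
        (\<lambda>v. (- 1) * (inverse (f x) * frechet_derivative f (at x) v * inverse (f x)))) (at x)"
      if "x \<in> S" for x
      using Deriv.has_derivative_inverse[OF _ Ck_on_has_derivative[OF Suc.prems that]] assms(3) that
      by simp
    show "Ck_on k S (\<lambda>x. (- 1) * (inverse (f x) * frechet_derivative f (at x) v * inverse (f x)))" for v
      by (intro Ck_on_mult Ck_on_const IH assms(1)) (use Suc.prems in auto)
  qed
qed

text \<open>The derivative of \<open>h = \<surd>\<bar>f\<bar>\<close> is \<open>f f' / (2 h\<^sup>3)\<close>, an expression in \<open>f\<close>, \<open>f'\<close> and \<open>h\<close>
  itself that does not depend on the sign of \<open>f\<close>, so smoothness follows by bootstrapping.\<close>
lemma Ck_on_sqrt_abs:
  fixes f :: "'a::real_normed_vector \<Rightarrow> real"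
  assumes "open S" "Ck_on k S f" "\<And>x. x \<in> S \<Longrightarrow> f x \<noteq> 0"
  shows "Ck_on k S (\<lambda>x. sqrt \<bar>f x\<bar>)"
  using assms(2)
proof (induction k)
  case 0
  then show ?case by (auto intro!: continuous_intros)
next
  case (Suc k)
  let ?h = "\<lambda>x. sqrt \<bar>f x\<bar>"
  note low = Ck_on_SucD[OF Suc.prems]
  note IH = Suc.IH[OF low]
  let ?D = "\<lambda>x v. f x * frechet_derivative f (at x) v * (1/2) *
      (inverse (?h x) * inverse (?h x) * inverse (?h x))"
  show ?case
  proof (rule Ck_on_SucI[OF assms(1)])
    show "(?h has_derivative ?D x) (at x)" if x: "x \<in> S" for x
    proof -
      have n0: "f x \<noteq> 0" by (rule assms(3)[OF x])
      have d: "(f has_derivative frechet_derivative f (at x)) (at x)"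
        by (rule Ck_on_has_derivative[OF Suc.prems x])
      have a: "((\<lambda>x. \<bar>f x\<bar>) has_derivative (\<lambda>v. frechet_derivative f (at x) v * sgn (f x))) (at x)"
        using has_derivative_compose[OF d has_derivative_norm[OF n0]] by simp
      have "(?h has_derivative
          (\<lambda>v. (frechet_derivative f (at x) v * sgn (f x)) * (inverse (?h x) / 2))) (at x)"
        using has_derivative_compose[OF a DERIV_real_sqrt[THEN has_field_derivative_imp_has_derivative]]
          n0        by (simp add: mult.commute)
      moreover have "sgn (f x) * inverse (?h x) =
          f x * (inverse (?h x) * inverse (?h x) * inverse (?h x))"
        using n0 by (auto simp: sgn_if field_simps)
      then have "(\<lambda>v. (frechet_derivative f (at x) v * sgn (f x)) * (inverse (?h x) / 2)) = ?D x"
        by (auto simp: fun_eq_iff algebra_simps)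
      ultimately show ?thesis by simp
    qed
    have "Ck_on k S (\<lambda>x. inverse (?h x))"
      by (rule Ck_on_inverse[OF assms(1) IH]) (use assms(3) in simp)
    then show "Ck_on k S (\<lambda>x. ?D x v)" for v
      by (intro Ck_on_mult Ck_on_const low assms(1)) (use Suc.prems in auto)
  qed
qed

text \<open>The mean value theorem is applied to \<open>s \<mapsto> f (z + ev + su) - f (z + su)\<close> and then to its
  derivative, as a function of the coefficient of \<open>v\<close>. The second difference is symmetric
  in \<open>u\<close> and \<open>v\<close>, so exchanging them expresses it by the other mixed derivative as well.\<close>
lemma second_difference_mvt:
  fixes f :: "'a::real_normed_vector \<Rightarrow> real"
  assumes f: "Ck_on 2 S f" and e: "0 < e"
    and seg: "\<And>s t. 0 \<le> s \<Longrightarrow> s \<le> e \<Longrightarrow> 0 \<le> t \<Longrightarrow> t \<le> e \<Longrightarrow> z + s *\<^sub>R u + t *\<^sub>R v \<in> S"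
  shows "\<exists>s t. 0 < s \<and> s < e \<and> 0 < t \<and> t < e \<and>
     f (z + e *\<^sub>R u + e *\<^sub>R v) - f (z + e *\<^sub>R u) - f (z + e *\<^sub>R v) + f z =
     e * e * frechet_derivative (\<lambda>x. frechet_derivative f (at x) u) (at (z + s *\<^sub>R u + t *\<^sub>R v)) v"
proof -
  have f2: "Ck_on (Suc (Suc 0)) S f" using f by (simp add: numeral_2_eq_2)
  let ?D = "\<lambda>x. frechet_derivative f (at x)"
  let ?E = "\<lambda>x. frechet_derivative (\<lambda>x. ?D x u) (at x)"
  have D: "(f has_derivative ?D x) (at x)" if "x \<in> S" for x
    using Ck_on_has_derivative[OF f2 that] .
  have E: "((\<lambda>x. ?D x u) has_derivative ?E x) (at x)" if "x \<in> S" for x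
    using f2 that by (simp add: frechet_derivative_works)
  have line_deriv: "((\<lambda>s. g (a + s *\<^sub>R w)) has_real_derivative g' w) (at r)"
    if "(g has_derivative g') (at (a + r *\<^sub>R w))" for g :: "'a \<Rightarrow> real" and g' a w r
  proof -
    have "((\<lambda>s. a + s *\<^sub>R w) has_derivative (\<lambda>s. s *\<^sub>R w)) (at r)"
      by (auto intro!: derivative_eq_intros)
    from has_derivative_compose[OF this that]
    have "((\<lambda>s. g (a + s *\<^sub>R w)) has_derivative (\<lambda>s. g' (s *\<^sub>R w))) (at r)" .
    moreover have "(\<lambda>s. g' (s *\<^sub>R w)) = (*) (g' w)"
      using has_derivative_linear[OF that] by (auto simp: linear_cmul)
    ultimately show ?thesis by (simp add: has_field_derivative_def)
  qed
  let ?p = "\<lambda>s. f ((z + e *\<^sub>R v) + s *\<^sub>R u) - f (z + s *\<^sub>R u)"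
  have "(?p has_real_derivative ?D ((z + e *\<^sub>R v) + s *\<^sub>R u) u - ?D (z + s *\<^sub>R u) u) (at s)"
    if "0 \<le> s" "s \<le> e" for s
    by (intro DERIV_diff line_deriv D) (use seg[of s e] seg[of s 0] that e in \<open>auto simp: algebra_simps\<close>)
  then have "\<exists>s. 0 < s \<and> s < e \<and>
      ?p e - ?p 0 = (e - 0) * (?D ((z + e *\<^sub>R v) + s *\<^sub>R u) u - ?D (z + s *\<^sub>R u) u)"
    by (intro MVT2 e) auto
  then obtain s where s: "0 < s" "s < e"
    and ps: "?p e - ?p 0 = e * (?D ((z + e *\<^sub>R v) + s *\<^sub>R u) u - ?D (z + s *\<^sub>R u) u)" by auto
  let ?q = "\<lambda>t. ?D ((z + s *\<^sub>R u) + t *\<^sub>R v) u"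
  have "(?q has_real_derivative ?E ((z + s *\<^sub>R u) + t *\<^sub>R v) v) (at t)"
    if "0 \<le> t" "t \<le> e" for t
    by (intro line_deriv E) (use seg[of s t] that s in auto)
  then have "\<exists>t. 0 < t \<and> t < e \<and> ?q e - ?q 0 = (e - 0) * ?E ((z + s *\<^sub>R u) + t *\<^sub>R v) v"
    by (intro MVT2 e) auto
  then obtain t where t: "0 < t" "t < e" and qt: "?q e - ?q 0 = e * ?E ((z + s *\<^sub>R u) + t *\<^sub>R v) v"
    by auto
  have "?p e - ?p 0 = e * (?q e - ?q 0)" using ps by (simp add: add.commute add.left_commute)
  then have "?p e - ?p 0 = e * e * ?E (z + s *\<^sub>R u + t *\<^sub>R v) v"
    unfolding qt by simp
  then show ?thesis using s t by (intro exI[of _ s] exI[of _ t]) (simp add: algebra_simps)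
qed

text \<open>The spray formula of a metric differentiates in \<open>x\<close> first, the Euler-Lagrange equation in \<open>y\<close>
  first. Both orders are limits of the same second difference quotient.\<close>
lemma second_derivative_symmetric:
  fixes f :: "'a::real_normed_vector \<Rightarrow> real"
  assumes S: "open S" and f: "Ck_on 2 S f" and z: "z \<in> S"
  shows "frechet_derivative (\<lambda>x. frechet_derivative f (at x) u) (at z) v =
         frechet_derivative (\<lambda>x. frechet_derivative f (at x) v) (at z) u"
proof (rule ccontr)
  let ?E = "\<lambda>u v x. frechet_derivative (\<lambda>x. frechet_derivative f (at x) u) (at x) v"
  assume ne: "?E u v z \<noteq> ?E v u z"
  define r where "r = \<bar>?E u v z - ?E v u z\<bar> / 2"
  have r: "r > 0" using ne by (simp add: r_def)
  have cont: "continuous_on S (?E u v)" for u v using f by (simp add: numeral_2_eq_2)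
  have near: "\<exists>d>0. \<forall>x. dist x z < d \<longrightarrow> x \<in> S \<and> \<bar>?E u v x - ?E u v z\<bar> < r" for u v
  proof -
    have "isCont (?E u v) z" using cont S z continuous_on_eq_continuous_at by blast
    then obtain d1 where d1: "d1 > 0" "\<And>x. dist x z < d1 \<Longrightarrow> dist (?E u v x) (?E u v z) < r"
      using r unfolding continuous_at_eps_delta by blast
    obtain d2 where d2: "d2 > 0" "ball z d2 \<subseteq> S" using S z open_contains_ball by blast
    show ?thesis
      by (rule exI[of _ "min d1 d2"]) (use d1 d2 in \<open>auto simp: dist_real_def dist_commute subset_iff\<close>)
  qed
  obtain d1 where d1: "d1 > 0" "\<And>x. dist x z < d1 \<Longrightarrow> x \<in> S \<and> \<bar>?E u v x - ?E u v z\<bar> < r"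
    using near by blast
  obtain d2 where d2: "d2 > 0" "\<And>x. dist x z < d2 \<Longrightarrow> x \<in> S \<and> \<bar>?E v u x - ?E v u z\<bar> < r"
    using near by blast
  define d where "d = min d1 d2"
  define e where "e = d / (norm u + norm v + 1)"
  have d: "d > 0" using d1 d2 by (simp add: d_def)
  have pos: "norm u + norm v + 1 > 0" by (simp add: add_nonneg_pos)
  have e: "e > 0" using d pos by (simp add: e_def)
  have close: "dist (z + s *\<^sub>R u + t *\<^sub>R v) z < d"
    if "0 \<le> s" "s \<le> e" "0 \<le> t" "t \<le> e" for s t
  proof -
    have "dist (z + s *\<^sub>R u + t *\<^sub>R v) z = norm (s *\<^sub>R u + t *\<^sub>R v)" by (simp add: dist_norm add.assoc)
    also have "\<dots> \<le> s * norm u + t * norm v"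
      using norm_triangle_ineq[of "s *\<^sub>R u" "t *\<^sub>R v"] that by simp
    also have "\<dots> \<le> e * norm u + e * norm v" using that by (intro add_mono mult_right_mono) auto
    also have "\<dots> < e * (norm u + norm v + 1)" using e by (simp add: algebra_simps)
    also have "\<dots> = d" using pos by (simp add: e_def)
    finally show ?thesis .
  qed
  have inS: "z + s *\<^sub>R u + t *\<^sub>R v \<in> S" if "0 \<le> s" "s \<le> e" "0 \<le> t" "t \<le> e" for s t
    using close[OF that] d1(2) by (simp add: d_def)
  have inS': "z + s *\<^sub>R v + t *\<^sub>R u \<in> S" if "0 \<le> s" "s \<le> e" "0 \<le> t" "t \<le> e" for s t
    using inS[of t s] that by (simp add: algebra_simps)
  let ?Q = "\<lambda>u v. f (z + e *\<^sub>R u + e *\<^sub>R v) - f (z + e *\<^sub>R u) - f (z + e *\<^sub>R v) + f z"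
  obtain s t where st: "0 < s" "s < e" "0 < t" "t < e"
    "?Q u v = e * e * ?E u v (z + s *\<^sub>R u + t *\<^sub>R v)"
    using second_difference_mvt[OF f e inS] by blast
  obtain s' t' where st': "0 < s'" "s' < e" "0 < t'" "t' < e"
    "?Q v u = e * e * ?E v u (z + s' *\<^sub>R v + t' *\<^sub>R u)"
    using second_difference_mvt[OF f e inS'] by blast
  have "?Q u v = ?Q v u" by (simp add: algebra_simps)
  then have "?E u v (z + s *\<^sub>R u + t *\<^sub>R v) = ?E v u (z + s' *\<^sub>R v + t' *\<^sub>R u)"
    using st(5) st'(5) e by simp
  moreover have "\<bar>?E u v (z + s *\<^sub>R u + t *\<^sub>R v) - ?E u v z\<bar> < r"
    using close[of s t] st d1(2) by (simp add: d_def)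
  moreover have "\<bar>?E v u (z + s' *\<^sub>R v + t' *\<^sub>R u) - ?E v u z\<bar> < r"
    using close[of t' s'] st' d2(2) by (simp add: d_def algebra_simps)
  ultimately show False unfolding r_def by argo
qed


section \<open>Homogeneous functions on fibrewise cones\<close>

definition fiber_cone :: "('a \<times> 'b::real_vector) set \<Rightarrow> bool" where
  "fiber_cone U \<longleftrightarrow> (\<forall>z\<in>U. \<forall>t>0. (fst z, t *\<^sub>R snd z) \<in> U)"

definition fiber_homogeneous :: "nat \<Rightarrow> ('a \<times> 'b::real_vector) set \<Rightarrow> ('a \<times> 'b \<Rightarrow> real) \<Rightarrow> bool" where
  "fiber_homogeneous m U f \<longleftrightarrow> (\<forall>z\<in>U. \<forall>t>0. f (fst z, t *\<^sub>R snd z) = t ^ m * f z)"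

lemma linear_axis_sum:
  fixes l :: "real^'n::finite \<Rightarrow> real"
  assumes "linear l"
  shows "l u = (\<Sum>k\<in>UNIV. u $ k * l (axis k 1))"
proof -
  have "l u = l (\<Sum>k\<in>UNIV. u $ k *\<^sub>R axis k 1)"
    using basis_expansion[of u] by (simp add: scalar_mult_eq_scaleR)
  then show ?thesis using assms by (simp add: linear_sum linear_cmul)
qed

lemma frechet_derivative_coordinates:
  fixes f :: "(real^'n::finite) \<times> (real^'n) \<Rightarrow> real"
  assumes "f differentiable (at z)"
  shows "frechet_derivative f (at z) (u, v) =
    (\<Sum>k\<in>UNIV. u $ k * dx k f z) + (\<Sum>k\<in>UNIV. v $ k * dy k f z)"
proof -
  let ?l = "frechet_derivative f (at z)"
  have l: "linear ?l" by (rule linear_frechet_derivative[OF assms])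
  have "?l (u, v) = ?l ((u, 0) + (0, v))" by simp
  also have "\<dots> = ?l (u, 0) + ?l (0, v)" by (rule linear_add[OF l])
  also have "?l (u, 0) = (\<Sum>k\<in>UNIV. u $ k * dx k f z)"
    unfolding dx_def
  proof (rule linear_axis_sum)
    show "linear (\<lambda>u. ?l (u, 0))"
      by (rule linear_compose[OF _ l, unfolded comp_def]) (simp add: linear_iff)
  qed
  also have "?l (0, v) = (\<Sum>k\<in>UNIV. v $ k * dy k f z)"
    unfolding dy_def
  proof (rule linear_axis_sum)
    show "linear (\<lambda>u. ?l (0, u))"
      by (rule linear_compose[OF _ l, unfolded comp_def]) (simp add: linear_iff)
  qed
  finally show ?thesis .
qed

lemma Ck_on_dx: "Ck_on (Suc k) U f \<Longrightarrow> Ck_on k U (dx i f)"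
  by (simp add: dx_def[abs_def])

lemma Ck_on_dy: "Ck_on (Suc k) U f \<Longrightarrow> Ck_on k U (dy i f)"
  by (simp add: dy_def[abs_def])

lemma Ck_on_differentiable: "Ck_on (Suc k) U f \<Longrightarrow> z \<in> U \<Longrightarrow> f differentiable (at z)"
  by simp

text \<open>Euler's theorem, by differentiating \<open>t \<mapsto> f (x, t y) = t\<^sup>m f (x, y)\<close> at \<open>t = 1\<close>.\<close>
lemma euler_homogeneous:
  fixes f :: "'a::real_normed_vector \<times> 'b::real_normed_vector \<Rightarrow> real"
  assumes h: "fiber_homogeneous m U f" and z: "z \<in> U" and d: "f differentiable (at z)"
  shows "frechet_derivative f (at z) (0, snd z) = real m * f z"
proof -
  let ?l = "frechet_derivative f (at z)"
  have "((\<lambda>t. (fst z, t *\<^sub>R snd z)) has_derivative (\<lambda>s. (0, s *\<^sub>R snd z))) (at 1)"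
    by (auto intro!: derivative_eq_intros)
  moreover have "(f has_derivative ?l) (at (fst z, 1 *\<^sub>R snd z))"
    using d by (simp add: frechet_derivative_works)
  ultimately have 1: "((\<lambda>t. f (fst z, t *\<^sub>R snd z)) has_derivative (\<lambda>s. ?l (0, s *\<^sub>R snd z))) (at (1::real))"
    by (rule has_derivative_compose)
  have "((\<lambda>t. t ^ m * f z) has_derivative (\<lambda>s. real m * s * f z)) (at (1::real))"
    by (auto intro!: derivative_eq_intros)
  then have 2: "((\<lambda>t. f (fst z, t *\<^sub>R snd z)) has_derivative (\<lambda>s. real m * s * f z)) (at (1::real))"
    by (rule has_derivative_transform_within_open[of _ _ _ _ "{0<..}"])
      (use h z in \<open>auto simp: fiber_homogeneous_def\<close>)
  from fun_cong[OF has_derivative_unique[OF 1 2], of 1] show ?thesis by simp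
qed

text \<open>Fibre scaling is linear, so the chain rule passes homogeneity on to the derivative, up to the
  scaling of its argument. Vertical arguments carry the factor \<open>t\<close>, which is why vertical derivatives
  lose one degree below.\<close>
lemma frechet_derivative_homogeneous:
  fixes f :: "'a::real_normed_vector \<times> 'b::real_normed_vector \<Rightarrow> real"
  assumes U: "open U" "fiber_cone U" and h: "fiber_homogeneous m U f"
    and d: "\<And>z. z \<in> U \<Longrightarrow> f differentiable (at z)"
    and z: "z \<in> U" and t: "t > 0"
  shows "frechet_derivative f (at (fst z, t *\<^sub>R snd z)) (u, t *\<^sub>R v) =
    t ^ m * frechet_derivative f (at z) (u, v)"
proof -
  let ?D = "\<lambda>z. frechet_derivative f (at z)"
  have "((\<lambda>w. (fst w, t *\<^sub>R snd w)) has_derivative (\<lambda>w. (fst w, t *\<^sub>R snd w))) (at z)"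
    by (auto intro!: derivative_eq_intros)
  moreover have "(f has_derivative ?D (fst z, t *\<^sub>R snd z)) (at (fst z, t *\<^sub>R snd z))"
    using d U z t by (auto simp: frechet_derivative_works[symmetric] fiber_cone_def)
  ultimately have 1: "((\<lambda>w. f (fst w, t *\<^sub>R snd w)) has_derivative
      (\<lambda>w. ?D (fst z, t *\<^sub>R snd z) (fst w, t *\<^sub>R snd w))) (at z)"
    by (rule has_derivative_compose)
  have "((\<lambda>w. t ^ m * f w) has_derivative (\<lambda>w. t ^ m * ?D z w)) (at z)"
    by (intro has_derivative_mult_right) (use d z in \<open>simp add: frechet_derivative_works\<close>)
  then have 2: "((\<lambda>w. f (fst w, t *\<^sub>R snd w)) has_derivative (\<lambda>w. t ^ m * ?D z w)) (at z)"
    by (rule has_derivative_transform_within_open[of _ _ _ _ U])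
      (use h z t U in \<open>auto simp: fiber_homogeneous_def\<close>)
  from fun_cong[OF has_derivative_unique[OF 1 2], of "(u, v)"] show ?thesis by simp
qed

lemma fiber_homogeneous_dy:
  fixes f :: "(real^'n::finite) \<times> (real^'n) \<Rightarrow> real"
  assumes "open U" "fiber_cone U" "fiber_homogeneous (Suc m) U f"
    and "\<And>z. z \<in> U \<Longrightarrow> f differentiable (at z)"
  shows "fiber_homogeneous m U (dy k f)"
  unfolding fiber_homogeneous_def
proof (intro ballI allI impI)
  fix z :: "(real^'n) \<times> (real^'n)" and t :: real
  assume z: "z \<in> U" and t: "t > 0"
  let ?w = "(fst z, t *\<^sub>R snd z)"
  have "f differentiable (at ?w)" using assms(2,4) z t by (auto simp: fiber_cone_def)
  from linear_frechet_derivative[OF this]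
  have "frechet_derivative f (at ?w) (t *\<^sub>R (0, axis k 1)) = t * dy k f ?w"
    unfolding dy_def by (simp only: linear_cmul real_scaleR_def)
  moreover have "frechet_derivative f (at ?w) (0, t *\<^sub>R axis k 1) = t ^ Suc m * dy k f z"
    unfolding dy_def by (rule frechet_derivative_homogeneous[OF assms z t])
  ultimately show "dy k f ?w = t ^ m * dy k f z" using t by simp
qed


section \<open>Hamel's equation as an Euler-Lagrange equation\<close>

text \<open>At \<open>h = G z\<close> the pair \<open>(y, - 2 h)\<close> is the value of the spray in coordinates. The equation only
  involves this value, not \<open>G\<close> as a function, hence the vector argument.\<close>
definition euler_lagrange ::
  "((real^'n) \<times> (real^'n) \<Rightarrow> real) \<Rightarrow> (real^'n) \<times> (real^'n) \<Rightarrow> real^'n::finite \<Rightarrow> bool" where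
  "euler_lagrange f z h \<longleftrightarrow>
     (\<forall>k. frechet_derivative (dy k f) (at z) (snd z, (- 2) *\<^sub>R h) = dx k f z)"

text \<open>\<open>f\<^sub>;\<^sub>0\<close> is the derivative of \<open>f\<close> along the spray, since \<open>G\<^sup>r\<^sub>i y\<^sup>i = 2 G\<^sup>r\<close> by Euler's theorem.\<close>
lemma hder0_eq_frechet_derivative:
  fixes f :: "(real^'n::finite) \<times> (real^'n) \<Rightarrow> real"
  assumes G: "\<And>r. fiber_homogeneous 2 U (\<lambda>z. G z $ r)"
    and dG: "\<And>r. (\<lambda>z. G z $ r) differentiable (at z)"
    and f: "f differentiable (at z)" and z: "z \<in> U"
  shows "hder0 G f z = frechet_derivative f (at z) (snd z, (- 2) *\<^sub>R G z)"
proof -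
  have conn: "(\<Sum>i\<in>UNIV. snd z $ i * conn1 G r i z) = 2 * G z $ r" for r
    using euler_homogeneous[OF G z dG, of r] frechet_derivative_coordinates[OF dG, of r 0 "snd z"]
    by (simp add: conn1_def)
  have "hder0 G f z = (\<Sum>i\<in>UNIV. snd z $ i * dx i f z) -
      (\<Sum>i\<in>UNIV. \<Sum>r\<in>UNIV. snd z $ i * conn1 G r i z * dy r f z)"
    by (simp add: hder0_def hder_def algebra_simps sum_subtractf sum_distrib_left)
  also have "(\<Sum>i\<in>UNIV. \<Sum>r\<in>UNIV. snd z $ i * conn1 G r i z * dy r f z) =
      (\<Sum>r\<in>UNIV. (\<Sum>i\<in>UNIV. snd z $ i * conn1 G r i z) * dy r f z)"
    by (subst sum.swap) (simp add: sum_distrib_right)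
  also have "\<dots> = (\<Sum>r\<in>UNIV. 2 * G z $ r * dy r f z)" by (simp add: conn)
  finally show ?thesis
    by (simp add: frechet_derivative_coordinates[OF f] sum_negf)
qed

text \<open>In \<open>f\<^sub>.\<^sub>k\<^sub>;\<^sub>0\<close> the second connection coefficients contract to \<open>G\<^sup>r\<^sub>k\<^sub>j y\<^sup>j = G\<^sup>r\<^sub>k\<close>. The resulting term
  \<open>G\<^sup>r\<^sub>k f\<^sub>.\<^sub>r\<close> is the one that distinguishes \<open>f\<^sub>;\<^sub>k\<close> from \<open>\<partial>\<^sub>k f\<close>, so it cancels.\<close>
lemma hamel_equation_iff:
  fixes f :: "(real^'n::finite) \<times> (real^'n) \<Rightarrow> real"
  assumes U: "open U" "fiber_cone U" and G: "\<And>r. fiber_homogeneous 2 U (\<lambda>z. G z $ r)"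
    and CG: "\<And>r. Ck_on 2 U (\<lambda>z. G z $ r)" and Cf: "Ck_on 2 U f" and z: "z \<in> U"
  shows "hder G k f z = vhder0 G k f z \<longleftrightarrow>
    frechet_derivative (dy k f) (at z) (snd z, (- 2) *\<^sub>R G z) = dx k f z"
proof -
  have CG': "Ck_on (Suc (Suc 0)) U (\<lambda>z. G z $ r)" for r using CG by (simp add: numeral_2_eq_2)
  have Cf': "Ck_on (Suc (Suc 0)) U f" using Cf by (simp add: numeral_2_eq_2)
  have conn: "(\<Sum>j\<in>UNIV. conn2 G r k j z * snd z $ j) = conn1 G r k z" for r
  proof -
    have "fiber_homogeneous 1 U (conn1 G r k)"
      unfolding conn1_def
      by (rule fiber_homogeneous_dy[OF U]) (use G[of r] Ck_on_differentiable[OF CG'] in \<open>simp_all add: numeral_2_eq_2\<close>)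
    moreover have d: "conn1 G r k differentiable (at z)"
      unfolding conn1_def by (rule Ck_on_differentiable[OF Ck_on_dy[OF CG'] z])
    ultimately show ?thesis
      using euler_homogeneous[OF _ z d] frechet_derivative_coordinates[OF d, of 0 "snd z"]
      by (simp add: conn2_def mult.commute)
  qed
  have "vhder0 G k f z = hder0 G (dy k f) z -
      (\<Sum>j\<in>UNIV. \<Sum>r\<in>UNIV. dy r f z * (conn2 G r k j z * snd z $ j))"
    by (simp add: vhder0_def vhder_def hder0_def left_diff_distrib sum_subtractf sum_distrib_right
        mult.assoc)
  also have "(\<Sum>j\<in>UNIV. \<Sum>r\<in>UNIV. dy r f z * (conn2 G r k j z * snd z $ j)) =
      (\<Sum>r\<in>UNIV. dy r f z * conn1 G r k z)"
    by (subst sum.swap) (simp add: conn sum_distrib_left[symmetric])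
  also have "hder0 G (dy k f) z = frechet_derivative (dy k f) (at z) (snd z, (- 2) *\<^sub>R G z)"
    by (rule hder0_eq_frechet_derivative[OF G Ck_on_differentiable[OF CG' z]
          Ck_on_differentiable[OF Ck_on_dy[OF Cf'] z] z])
  finally show ?thesis by (auto simp: hder_def mult.commute)
qed

text \<open>A multiple of \<open>y\<close> adds a vertical term along \<open>y\<close>, which kills functions of degree zero such as
  \<open>f\<^sub>.\<^sub>k\<close>.\<close>
lemma euler_lagrange_projective:
  fixes f :: "(real^'n::finite) \<times> (real^'n) \<Rightarrow> real"
  assumes U: "open U" "fiber_cone U" and h: "fiber_homogeneous 1 U f" and Cf: "Ck_on 2 U f"
    and z: "z \<in> U"
  shows "euler_lagrange f z (v + p *\<^sub>R snd z) \<longleftrightarrow> euler_lagrange f z v"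
proof -
  have Cf': "Ck_on (Suc (Suc 0)) U f" using Cf by (simp add: numeral_2_eq_2)
  have "frechet_derivative (dy k f) (at z) (snd z, (- 2) *\<^sub>R (v + p *\<^sub>R snd z)) =
      frechet_derivative (dy k f) (at z) (snd z, (- 2) *\<^sub>R v)" for k
  proof -
    let ?l = "frechet_derivative (dy k f) (at z)"
    have d: "dy k f differentiable (at z)" by (rule Ck_on_differentiable[OF Ck_on_dy[OF Cf'] z])
    have l: "linear ?l" by (rule linear_frechet_derivative[OF d])
    have "fiber_homogeneous 0 U (dy k f)"
      by (rule fiber_homogeneous_dy[OF U]) (use h Ck_on_differentiable[OF Cf'] in simp_all)
    from euler_homogeneous[OF this z d] have 0: "?l (0, snd z) = 0" by simp
    have "?l (snd z, (- 2) *\<^sub>R (v + p *\<^sub>R snd z)) =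
        ?l ((snd z, (- 2) *\<^sub>R v) + (- 2 * p) *\<^sub>R (0, snd z))"
      by (simp add: algebra_simps)
    also have "\<dots> = ?l (snd z, (- 2) *\<^sub>R v) + (- 2 * p) * ?l (0, snd z)"
      by (simp only: linear_add[OF l] linear_cmul[OF l] real_scaleR_def)
    finally show ?thesis by (simp add: 0)
  qed
  then show ?thesis by (simp add: euler_lagrange_def)
qed

text \<open>The derivative of Euler's identity \<open>y\<^sup>k f\<^sub>.\<^sub>k = f\<close> in the direction \<open>(u, v)\<close>. For \<open>u = y\<close> it says that the
  Euler-Lagrange equation of a function of degree one always holds after contraction with \<open>y\<close>.\<close>
lemma contracted_vertical_derivative:
  fixes f :: "(real^'n::finite) \<times> (real^'n) \<Rightarrow> real"
  assumes U: "open U" and h: "fiber_homogeneous 1 U f" and Cf: "Ck_on 2 U f" and z: "z \<in> U"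
  shows "(\<Sum>k\<in>UNIV. snd z $ k * frechet_derivative (dy k f) (at z) (u, v)) =
    (\<Sum>k\<in>UNIV. u $ k * dx k f z)"
proof -
  have Cf': "Ck_on (Suc (Suc 0)) U f" using Cf by (simp add: numeral_2_eq_2)
  let ?l = "\<lambda>k. frechet_derivative (dy k f) (at z)"
  have "((\<lambda>w. snd w $ k * dy k f w) has_derivative
      (\<lambda>w. snd z $ k * ?l k w + snd w $ k * dy k f z)) (at z)" for k
    by (intro has_derivative_mult Ck_on_has_derivative[OF Ck_on_dy[OF Cf'] z]
        bounded_linear_imp_has_derivative
        bounded_linear_compose[OF bounded_linear_vec_nth bounded_linear_snd])
  then have "((\<lambda>w. \<Sum>k\<in>UNIV. snd w $ k * dy k f w) has_derivative
      (\<lambda>w. \<Sum>k\<in>UNIV. snd z $ k * ?l k w + snd w $ k * dy k f z)) (at z)"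
    by (rule has_derivative_sum)
  then have "(f has_derivative
      (\<lambda>w. \<Sum>k\<in>UNIV. snd z $ k * ?l k w + snd w $ k * dy k f z)) (at z)"
  proof (rule has_derivative_transform_within_open[OF _ U z])
    fix w assume w: "w \<in> U"
    have d: "f differentiable (at w)" by (rule Ck_on_differentiable[OF Cf' w])
    show "(\<Sum>k\<in>UNIV. snd w $ k * dy k f w) = f w"
      using euler_homogeneous[OF h w d] frechet_derivative_coordinates[OF d, of 0 "snd w"] by simp
  qed
  from fun_cong[OF frechet_derivative_at[OF this], of "(u, v)"] show ?thesis
    by (simp add: frechet_derivative_coordinates[OF Ck_on_differentiable[OF Cf' z]] sum.distrib)
qed

text \<open>Let \<open>S\<close> be differentiation along \<open>(y, - 2 v)\<close>. The equation for \<open>c F\<^sup>2\<close> reads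
  \<open>(S F) F\<^sub>.\<^sub>k + F S (F\<^sub>.\<^sub>k) = F \<partial>\<^sub>k F\<close>. Contracting with \<open>y\<^sup>k\<close> leaves \<open>(S F) F = 0\<close>, because the
  contracted equation for \<open>F\<close> is an identity, and then the equation for \<open>F\<close> remains.\<close>
lemma euler_lagrange_square_iff:
  fixes F L :: "(real^'n::finite) \<times> (real^'n) \<Rightarrow> real"
  assumes U: "open U" and h: "fiber_homogeneous 1 U F" and CF: "Ck_on 2 U F"
    and V: "open V" "V \<subseteq> U" "z \<in> V" and L: "\<And>w. w \<in> V \<Longrightarrow> L w = c * (F w)\<^sup>2"
    and c: "c \<noteq> 0" and Fz: "F z \<noteq> 0"
  shows "euler_lagrange L z v \<longleftrightarrow>
    euler_lagrange F z v \<and> frechet_derivative F (at z) (snd z, (- 2) *\<^sub>R v) = 0"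
proof -
  have CF': "Ck_on (Suc (Suc 0)) U F" using CF by (simp add: numeral_2_eq_2)
  let ?D = "\<lambda>w. frechet_derivative F (at w)"
  let ?v = "(snd z, (- 2) *\<^sub>R v)"
  have z: "z \<in> U" using V by blast
  have DL: "frechet_derivative L (at w) = (\<lambda>u. 2 * c * F w * ?D w u)" if w: "w \<in> V" for w
  proof (rule frechet_derivative_at[symmetric])
    have "(F has_derivative ?D w) (at w)" using Ck_on_has_derivative[OF CF'] w V by blast
    then have "((\<lambda>w. c * (F w)\<^sup>2) has_derivative (\<lambda>u. 2 * c * F w * ?D w u)) (at w)"
      by (auto intro!: derivative_eq_intros)
    then show "(L has_derivative (\<lambda>u. 2 * c * F w * ?D w u)) (at w)"
      by (rule has_derivative_transform_within_open[OF _ V(1) w]) (simp add: L)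
  qed
  have DDL: "frechet_derivative (dy k L) (at z) ?v = 2 * c * (?D z ?v * dy k F z +
      F z * frechet_derivative (dy k F) (at z) ?v)" for k
  proof -
    have "((\<lambda>w. 2 * c * (F w * dy k F w)) has_derivative
        (\<lambda>u. 2 * c * (F z * frechet_derivative (dy k F) (at z) u + ?D z u * dy k F z))) (at z)"
      by (intro has_derivative_mult_right has_derivative_mult Ck_on_has_derivative[OF CF' z]
          Ck_on_has_derivative[OF Ck_on_dy[OF CF'] z])
    then have "(dy k L has_derivative
        (\<lambda>u. 2 * c * (F z * frechet_derivative (dy k F) (at z) u + ?D z u * dy k F z))) (at z)"
      by (rule has_derivative_transform_within_open[OF _ V(1,3)]) (simp add: dy_def DL)
    from fun_cong[OF frechet_derivative_at[OF this], of ?v] show ?thesis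
      by (simp add: algebra_simps)
  qed
  have dxL: "dx k L z = 2 * c * (F z * dx k F z)" for k
    using V by (simp add: dx_def DL)
  have EL: "euler_lagrange L z v \<longleftrightarrow> (\<forall>k. ?D z ?v * dy k F z +
      F z * frechet_derivative (dy k F) (at z) ?v = F z * dx k F z)"
    unfolding euler_lagrange_def DDL dxL using c by simp
  show ?thesis
  proof
    assume "euler_lagrange L z v"
    then have eq: "?D z ?v * dy k F z + F z * frechet_derivative (dy k F) (at z) ?v =
        F z * dx k F z" for k using EL by blast
    have euler: "(\<Sum>k\<in>UNIV. snd z $ k * dy k F z) = F z"
      using euler_homogeneous[OF h z] frechet_derivative_coordinates[of F z 0 "snd z"]
        Ck_on_differentiable[OF CF' z] by simp
    have "(\<Sum>k\<in>UNIV. snd z $ k * (?D z ?v * dy k F z +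
        F z * frechet_derivative (dy k F) (at z) ?v)) = (\<Sum>k\<in>UNIV. snd z $ k * (F z * dx k F z))"
      by (simp only: eq)
    moreover have "(\<Sum>k\<in>UNIV. snd z $ k * (?D z ?v * dy k F z +
        F z * frechet_derivative (dy k F) (at z) ?v)) = ?D z ?v * (\<Sum>k\<in>UNIV. snd z $ k * dy k F z) +
        F z * (\<Sum>k\<in>UNIV. snd z $ k * frechet_derivative (dy k F) (at z) ?v)"
      by (simp add: distrib_left sum.distrib sum_distrib_left mult.left_commute)
    moreover have "(\<Sum>k\<in>UNIV. snd z $ k * (F z * dx k F z)) = F z * (\<Sum>k\<in>UNIV. snd z $ k * dx k F z)"
      by (simp add: sum_distrib_left mult.left_commute)
    ultimately have "?D z ?v * F z = 0"
      by (simp add: euler contracted_vertical_derivative[OF U h CF z])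
    then have 0: "?D z ?v = 0" using Fz by simp
    moreover have "euler_lagrange F z v"
      unfolding euler_lagrange_def using eq[unfolded 0] Fz by simp
    ultimately show "euler_lagrange F z v \<and> ?D z ?v = 0" by simp
  qed (simp add: EL, simp add: euler_lagrange_def)
qed

text \<open>Written out, the Euler-Lagrange equation is \<open>4 g\<^sub>k\<^sub>r h\<^sup>r = y\<^sup>j \<partial>\<^sub>j L\<^sub>.\<^sub>k - \<partial>\<^sub>k L\<close>.\<close>
lemma euler_lagrange_iff_finsler_coeffs:
  fixes L :: "(real^'n::finite) \<times> (real^'n) \<Rightarrow> real"
  assumes U: "open U" and CL: "Ck_on 2 U L" and z: "z \<in> U"
    and inv: "invertible (fundamental_tensor L z)"
  shows "euler_lagrange L z h \<longleftrightarrow> h = finsler_coeffs L z"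
proof -
  have CL': "Ck_on (Suc (Suc 0)) U L" using CL by (simp add: numeral_2_eq_2)
  let ?g = "fundamental_tensor L z"
  \<comment> \<open>\<open>b\<close> is the right-hand side of the linear system, with the derivatives in the order of the
    spray formula\<close>
  define b :: "real^'n" where "b = (\<chi> k. (\<Sum>j\<in>UNIV. dy k (dx j L) z * snd z $ j) - dx k L z)"
  have dhalf: "dy k (\<lambda>w. 1/2 * L w) w = 1/2 * dy k L w" if "w \<in> U" for k w
    unfolding dy_def
    using fun_cong[OF frechet_derivative_at[OF
          has_derivative_mult_right[OF Ck_on_has_derivative[OF CL' that], of "1/2"]]]
    by simp
  have g: "?g $ k $ r = 1/2 * dy r (dy k L) z" for k r
  proof -
    have "((\<lambda>w. 1/2 * dy k L w) has_derivative
        (\<lambda>u. 1/2 * frechet_derivative (dy k L) (at z) u)) (at z)"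
      by (rule has_derivative_mult_right[OF Ck_on_has_derivative[OF Ck_on_dy[OF CL'] z]])
    then have "(dy k (\<lambda>w. 1/2 * L w) has_derivative
        (\<lambda>u. 1/2 * frechet_derivative (dy k L) (at z) u)) (at z)"
      by (rule has_derivative_transform_within_open[OF _ U z]) (rule dhalf[symmetric])
    from fun_cong[OF frechet_derivative_at[OF this], of "(0, axis r 1)"] show ?thesis
      by (simp add: fundamental_tensor_def dy_def[of r])
  qed
  have swap: "dx j (dy k L) z = dy k (dx j L) z" for j k
    using second_derivative_symmetric[OF U CL z, of "(0, axis k 1)" "(axis j 1, 0)"]
    by (simp add: dx_def[abs_def] dy_def[abs_def])
  have "frechet_derivative (dy k L) (at z) (snd z, (- 2) *\<^sub>R h) =
      b $ k + dx k L z - 4 * (?g *v h) $ k" for k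
    unfolding frechet_derivative_coordinates[OF Ck_on_differentiable[OF Ck_on_dy[OF CL'] z]]
    by (simp add: b_def swap matrix_vector_mult_def g sum_distrib_left sum_negf mult.commute mult.left_commute)
  then have EL: "euler_lagrange L z h \<longleftrightarrow> ?g *v h = (1/4) *\<^sub>R b"
    by (auto simp: euler_lagrange_def vec_eq_iff field_simps)
  have coeffs: "finsler_coeffs L z = matrix_inv ?g *v ((1/4) *\<^sub>R b)"
    by (simp add: vec_eq_iff finsler_coeffs_def matrix_vector_mult_def b_def sum_distrib_left
        mult.commute mult.left_commute)
  have ii: "?g ** matrix_inv ?g = mat 1" "matrix_inv ?g ** ?g = mat 1"
    using inv someI_ex[of "\<lambda>A'. ?g ** A' = mat 1 \<and> A' ** ?g = mat 1"]
    unfolding invertible_def matrix_inv_def by blast+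
  show ?thesis
    unfolding EL coeffs
    by (metis ii matrix_vector_mul_assoc matrix_vector_mul_lid)
qed


section \<open>Coordinates on a conical region\<close>

lemma tangent_vector_transform:
  assumes "\<xi> \<in> tangent_space A p" "c \<in> A" "d \<in> A" "p \<in> fst c" "p \<in> fst d"
  shows "\<xi> d = frechet_derivative (transition c d) (at (snd c p)) (\<xi> c)"
  using assms unfolding tangent_space_def by blast

text \<open>A tangent vector is determined by one component through the transition maps, and its components
  in charts away from its base point are all zero.\<close>
lemma inj_on_tangent_chart:
  assumes A: "smooth_atlas M A" and c: "c \<in> tangent_atlas M A"
  shows "inj_on (snd c) (fst c)"
proof (rule inj_onI)
  fix q q' assume q: "q \<in> fst c" "q' \<in> fst c" and eq: "snd c q = snd c q'"
  obtain a where a: "a \<in> A" "c = tangent_chart M A a" using c by (auto simp: tangent_atlas_def)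
  have inj: "inj_on (snd a) (fst a)" using A a by (simp add: smooth_atlas_def)
  have p: "fst q = fst q'"
    using inj q eq by (auto simp: a tangent_chart_def inj_on_def)
  have va: "snd q a = snd q' a" using eq by (simp add: a tangent_chart_def)
  have pa: "fst q \<in> fst a" using q by (simp add: a tangent_chart_def)
  have ts: "snd q \<in> tangent_space A (fst q)" "snd q' \<in> tangent_space A (fst q)"
    using q p by (auto simp: a tangent_chart_def tangent_bundle_def)
  have "snd q d = snd q' d" for d
  proof (cases "d \<in> A \<and> fst q \<in> fst d")
    case True
    then have d: "d \<in> A" "fst q \<in> fst d" by auto
    show ?thesis
      unfolding tangent_vector_transform[OF ts(1) a(1) d(1) pa d(2)]
        tangent_vector_transform[OF ts(2) a(1) d(1) pa d(2)] va ..
  next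
    case False
    then have "snd q d = 0" "snd q' d = 0" using ts unfolding tangent_space_def by blast+
    then show ?thesis by simp
  qed
  then show "q = q'" using p by (auto simp: prod_eq_iff)
qed

lemma conical_region_openin:
  assumes "smooth_atlas M A" "conical_region M A C"
  shows "C \<subseteq> tangent_bundle M A \<and> (\<forall>c\<in>tangent_atlas M A. open (chart_image C c))"
  using assms(2) openin_atlas_topology[OF inj_on_tangent_chart[OF assms(1)]]
  by (simp add: conical_region_def)

lemma open_chart_image:
  assumes "smooth_atlas M A" "conical_region M A C" "c \<in> tangent_atlas M A"
  shows "open (chart_image C c)"
  using conical_region_openin[OF assms(1,2)] assms(3) by blast

lemma chart_inv_snd:
  assumes "smooth_atlas M A" "c \<in> tangent_atlas M A" "q \<in> fst c"
  shows "chart_inv c (snd c q) = q"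
  using inj_on_tangent_chart[OF assms(1,2)] assms(3) by (simp add: chart_inv_def)

lemma snd_in_chart_image: "q \<in> C \<Longrightarrow> q \<in> fst c \<Longrightarrow> snd c q \<in> chart_image C c"
  by (simp add: chart_image_def)

lemma chart_imageE:
  assumes "smooth_atlas M A" "c \<in> tangent_atlas M A" "z \<in> chart_image C c"
  shows "chart_inv c z \<in> C" "chart_inv c z \<in> fst c" "snd c (chart_inv c z) = z"
  using assms(3) chart_inv_snd[OF assms(1,2)] by (auto simp: chart_image_def)

lemma tangent_chart_scale_vec:
  assumes "smooth_atlas M A" "conical_region M A C" "c \<in> tangent_atlas M A"
    and "q \<in> C" "q \<in> fst c" "0 < t"
  shows "scale_vec t q \<in> C" "scale_vec t q \<in> fst c"
    "snd c (scale_vec t q) = (fst (snd c q), t *\<^sub>R snd (snd c q))"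
proof -
  show C: "scale_vec t q \<in> C" using assms by (simp add: conical_region_def)
  obtain a where a: "c = tangent_chart M A a" using assms(3) by (auto simp: tangent_atlas_def)
  show "scale_vec t q \<in> fst c"
    using C conical_region_openin[OF assms(1,2)] assms(5)
    by (auto simp: a tangent_chart_def scale_vec_def)
  show "snd c (scale_vec t q) = (fst (snd c q), t *\<^sub>R snd (snd c q))"
    by (simp add: a tangent_chart_def scale_vec_def)
qed

lemma fiber_cone_chart_image:
  assumes "smooth_atlas M A" "conical_region M A C" "c \<in> tangent_atlas M A"
  shows "fiber_cone (chart_image C c)"
  unfolding fiber_cone_def
proof (intro ballI allI impI)
  fix z and t :: real assume z: "z \<in> chart_image C c" and t: "t > 0"
  note q = chart_imageE[OF assms(1,3) z]
  show "(fst z, t *\<^sub>R snd z) \<in> chart_image C c"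
    using snd_in_chart_image[OF tangent_chart_scale_vec(1,2)[OF assms q(1,2) t]]
      tangent_chart_scale_vec(3)[OF assms q(1,2) t] q(3) by simp
qed

lemma fiber_homogeneous_chart_inv:
  assumes "smooth_atlas M A" "conical_region M A C" "c \<in> tangent_atlas M A"
    and "pos_homogeneous m C f"
  shows "fiber_homogeneous m (chart_image C c) (f \<circ> chart_inv c)"
  unfolding fiber_homogeneous_def
proof (intro ballI allI impI)
  fix z and t :: real assume z: "z \<in> chart_image C c" and t: "t > 0"
  note q = chart_imageE[OF assms(1,3) z]
  have "chart_inv c (fst z, t *\<^sub>R snd z) = scale_vec t (chart_inv c z)"
    using chart_inv_snd[OF assms(1,3) tangent_chart_scale_vec(2)[OF assms(1-3) q(1,2) t]]
      tangent_chart_scale_vec(3)[OF assms(1-3) q(1,2) t] q(3) by simp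
  then show "(f \<circ> chart_inv c) (fst z, t *\<^sub>R snd z) = t ^ m * (f \<circ> chart_inv c) z"
    using assms(4) q t by (simp add: pos_homogeneous_def)
qed

lemma smooth_fun_Ck_on:
  "smooth_fun B C f \<Longrightarrow> c \<in> B \<Longrightarrow> Ck_on k (chart_image C c) (f \<circ> chart_inv c)"
  by (simp add: smooth_fun_def smooth_on_def)


section \<open>Change of coordinates on the tangent bundle\<close>

text \<open>The transition map of two tangent charts is \<open>(x, y) \<mapsto> (\<phi> x, D\<phi>(x) y)\<close>. It is differentiable
  because \<open>\<phi>\<close> is smooth, and its derivative maps \<open>(0, y)\<close> to \<open>(0, D\<phi>(x) y)\<close> because it is linear
  on fibres: the Liouville field is chart independent. The neighbourhood \<open>W\<close> is cut out of the
  conical region, whose coordinate images are open. That the full domain of the transition map is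
  open would require that every vector of \<open>real^'n\<close> is a component of some tangent vector.\<close>
lemma tangent_transition:
  fixes M :: "'m set" and A :: "('m, real^'n::finite) chart set"
  assumes A: "smooth_atlas M A" and C: "conical_region M A C"
    and cd: "c \<in> tangent_atlas M A" "d \<in> tangent_atlas M A"
    and q: "q \<in> C" "q \<in> fst c" "q \<in> fst d"
  obtains W where "open W" "snd c q \<in> W" "W \<subseteq> chart_image C c" "fiber_cone W"
    and "\<And>w. w \<in> W \<Longrightarrow> chart_inv c w \<in> C \<inter> fst c \<inter> fst d"
    and "transition c d differentiable (at (snd c q))"
    and "frechet_derivative (transition c d) (at (snd c q)) (0, snd (snd c q)) =
      (0, snd (snd d q))"
proof -
  obtain a where a: "a \<in> A" "c = tangent_chart M A a" using cd by (auto simp: tangent_atlas_def)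
  obtain b where b: "b \<in> A" "d = tangent_chart M A b" using cd by (auto simp: tangent_atlas_def)
  have inja: "inj_on (snd a) (fst a)" using A a by (simp add: smooth_atlas_def)
  let ?\<phi> = "transition a b"
  let ?N = "chart_image (fst b) a"
  have N: "open ?N" and \<phi>: "smooth_on ?N ?\<phi>" using A a b by (auto simp: smooth_atlas_def)
  have \<phi>2: "Ck_on (Suc (Suc 0)) ?N ?\<phi>" using \<phi> unfolding smooth_on_def by blast
  let ?W = "chart_image (C \<inter> fst d) c"
  have CT: "C \<subseteq> tangent_bundle M A" using conical_region_openin[OF A C] by blast
  have Weq: "?W = chart_image C c \<inter> fst -` ?N"
  proof (rule set_eqI)
    fix w
    show "w \<in> ?W \<longleftrightarrow> w \<in> chart_image C c \<inter> fst -` ?N"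
    proof
      assume "w \<in> ?W"
      then show "w \<in> chart_image C c \<inter> fst -` ?N"
        by (auto simp: chart_image_def a b tangent_chart_def)
    next
      assume w: "w \<in> chart_image C c \<inter> fst -` ?N"
      then obtain q' where q': "q' \<in> C" "q' \<in> fst c" "w = snd c q'" by (auto simp: chart_image_def)
      have "snd a (fst q') \<in> snd a ` (fst b \<inter> fst a)" and pa: "fst q' \<in> fst a"
        using w q' by (auto simp: a tangent_chart_def chart_image_def)
      then have "fst q' \<in> fst b" using inja by (auto simp: inj_on_def)
      then have "q' \<in> fst d" using q' CT by (auto simp: b tangent_chart_def)
      then show "w \<in> ?W" using q' by (auto simp: chart_image_def)
    qed
  qed
  have openW: "open ?W"
    unfolding Weq using open_chart_image[OF A C cd(1)] N by (auto intro: open_vimage_fst)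
  have WN: "fst w \<in> ?N" if "w \<in> ?W" for w using that Weq by auto
  have inv: "chart_inv c w \<in> C \<inter> fst c \<inter> fst d" if "w \<in> ?W" for w
    using chart_imageE[OF A cd(1) that] by blast
  have cone: "fiber_cone ?W"
    using fiber_cone_chart_image[OF A C cd(1)] by (auto simp: Weq fiber_cone_def)
  have zW: "snd c q \<in> ?W" using q by (auto simp: chart_image_def)
  let ?z = "snd c q"
  let ?D = "\<lambda>x. frechet_derivative ?\<phi> (at x)"
  have T: "transition c d w = (?\<phi> (fst w), ?D (fst w) (snd w))" if w: "w \<in> ?W" for w
  proof -
    let ?q = "chart_inv c w"
    note r = chart_imageE[OF A cd(1) w]
    have pa: "fst ?q \<in> fst a" "fst ?q \<in> fst b" and ts: "snd ?q \<in> tangent_space A (fst ?q)"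
      using r by (auto simp: a b tangent_chart_def tangent_bundle_def)
    have w': "w = (snd a (fst ?q), snd ?q a)" using r(3) by (simp add: a tangent_chart_def)
    have 1: "fst w = snd a (fst ?q)" and 2: "snd w = snd ?q a" by (subst w', simp)+
    have 3: "?\<phi> (fst w) = snd b (fst ?q)"
      using inja pa by (simp add: transition_def chart_inv_def 1)
    have 4: "snd ?q b = ?D (fst w) (snd w)"
      using tangent_vector_transform[OF ts a(1) b(1) pa] by (simp add: 1 2)
    have "transition c d w = (snd b (fst ?q), snd ?q b)"
      by (simp add: transition_def b tangent_chart_def)
    then show ?thesis by (simp add: 3 4)
  qed
  have lin: "linear (?D (fst w))" if "w \<in> ?W" for w
    by (rule linear_frechet_derivative) (use WN[OF that] \<phi>2 in simp)
  have T': "transition c d w = (?\<phi> (fst w), \<Sum>k\<in>UNIV. snd w $ k *\<^sub>R ?D (fst w) (axis k 1))"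
    if w: "w \<in> ?W" for w
  proof -
    have "?D (fst w) (\<Sum>k\<in>UNIV. snd w $ k *\<^sub>R axis k 1) = ?D (fst w) (snd w)"
      using basis_expansion[of "snd w"] by (simp add: scalar_mult_eq_scaleR)
    then show ?thesis unfolding T[OF w] by (simp add: linear_sum[OF lin[OF w]] linear_cmul[OF lin[OF w]])
  qed
  have fstd: "f \<circ> fst differentiable (at ?z)" if "f differentiable (at (fst ?z))"
    for f :: "real^'n \<Rightarrow> real^'n"
    by (intro differentiable_chain_at that bounded_linear_imp_differentiable bounded_linear_fst)
  have d1: "(\<lambda>w. ?\<phi> (fst w)) differentiable (at ?z)"
    using fstd[of ?\<phi>] WN[OF zW] \<phi>2 by (simp add: comp_def)
  have d2: "(\<lambda>w. ?D (fst w) e) differentiable (at ?z)" for e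
    using fstd[of "\<lambda>x. ?D x e"] WN[OF zW] \<phi>2 by (simp add: comp_def)
  have d3: "(\<lambda>w. snd w $ k :: real) differentiable (at ?z)" for k :: 'n
    by (intro bounded_linear_imp_differentiable
        bounded_linear_compose[OF bounded_linear_vec_nth bounded_linear_snd])
  have dT: "transition c d differentiable (at ?z)"
  proof -
    have "(\<lambda>w. (?\<phi> (fst w), \<Sum>k\<in>UNIV. snd w $ k *\<^sub>R ?D (fst w) (axis k 1)))
        differentiable (at ?z)"
      by (intro differentiable_Pair differentiable_sum differentiable_scaleR ballI d1 d2 d3) auto
    then obtain D' where "((\<lambda>w. (?\<phi> (fst w), \<Sum>k\<in>UNIV. snd w $ k *\<^sub>R ?D (fst w) (axis k 1)))
        has_derivative D') (at ?z)" by (auto simp: differentiable_def)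
    then have "(transition c d has_derivative D') (at ?z)"
      by (rule has_derivative_transform_within_open[OF _ openW zW]) (simp add: T')
    then show ?thesis by (auto simp: differentiable_def)
  qed
  have Tz: "transition c d ?z = snd d q"
    using chart_inv_snd[OF A cd(1) q(2)] by (simp add: transition_def)
  have "((\<lambda>t. (fst ?z, t *\<^sub>R snd ?z)) has_derivative (\<lambda>s. (0, s *\<^sub>R snd ?z))) (at (1::real))"
    by (auto intro!: derivative_eq_intros)
  moreover have "(transition c d has_derivative frechet_derivative (transition c d) (at ?z))
      (at (fst ?z, 1 *\<^sub>R snd ?z))"
    using dT by (simp add: frechet_derivative_works)
  ultimately have 1: "((\<lambda>t. transition c d (fst ?z, t *\<^sub>R snd ?z)) has_derivative
      (\<lambda>s. frechet_derivative (transition c d) (at ?z) (0, s *\<^sub>R snd ?z))) (at (1::real))"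
    by (rule has_derivative_compose)
  have "((\<lambda>t. (fst (snd d q), t *\<^sub>R snd (snd d q))) has_derivative
      (\<lambda>s. (0, s *\<^sub>R snd (snd d q)))) (at (1::real))"
    by (auto intro!: derivative_eq_intros)
  then have 2: "((\<lambda>t. transition c d (fst ?z, t *\<^sub>R snd ?z)) has_derivative
      (\<lambda>s. (0, s *\<^sub>R snd (snd d q)))) (at (1::real))"
  proof (rule has_derivative_transform_within_open[of _ _ _ _ "{0<..}"])
    fix t :: real assume "t \<in> {0<..}"
    then have tW: "(fst ?z, t *\<^sub>R snd ?z) \<in> ?W" using cone zW by (simp add: fiber_cone_def)
    have "snd d q = (?\<phi> (fst ?z), ?D (fst ?z) (snd ?z))" using T[OF zW] Tz by simp
    then show "(fst (snd d q), t *\<^sub>R snd (snd d q)) = transition c d (fst ?z, t *\<^sub>R snd ?z)"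
      by (simp add: T[OF tW] linear_cmul[OF lin[OF zW]])
  qed auto
  have "frechet_derivative (transition c d) (at ?z) (0, snd ?z) = (0, snd (snd d q))"
    using fun_cong[OF has_derivative_unique[OF 1 2], of 1] by simp
  then show thesis
    using that[OF openW zW _ cone inv dT] Weq by blast
qed

text \<open>The derivative of a function along a tangent vector is chart independent, by the chain rule.\<close>
lemma frechet_derivative_change_chart:
  fixes M :: "'m set" and A :: "('m, real^'n::finite) chart set"
    and f :: "('m, 'n) tpoint \<Rightarrow> real"
  assumes A: "smooth_atlas M A" and C: "conical_region M A C"
    and cd: "c \<in> tangent_atlas M A" "d \<in> tangent_atlas M A"
    and q: "q \<in> C" "q \<in> fst c" "q \<in> fst d"
    and f: "smooth_fun (tangent_atlas M A) C f"
    and X: "X \<in> tangent_space (tangent_atlas M A) q"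
  shows "frechet_derivative (f \<circ> chart_inv c) (at (snd c q)) (X c) =
    frechet_derivative (f \<circ> chart_inv d) (at (snd d q)) (X d)"
proof -
  obtain W where W: "open W" "snd c q \<in> W"
    and inv: "\<And>w. w \<in> W \<Longrightarrow> chart_inv c w \<in> C \<inter> fst c \<inter> fst d"
    and dT: "transition c d differentiable (at (snd c q))"
    using tangent_transition[OF A C cd q] by metis
  let ?T = "transition c d"
  have Tz: "?T (snd c q) = snd d q"
    using chart_inv_snd[OF A cd(1) q(2)] by (simp add: transition_def)
  have "(f \<circ> chart_inv d) differentiable (at (snd d q))"
    by (rule Ck_on_differentiable[OF smooth_fun_Ck_on[OF f cd(2), of "Suc 0"]])
      (use q in \<open>simp add: snd_in_chart_image\<close>)
  then have "((f \<circ> chart_inv d) has_derivative frechet_derivative (f \<circ> chart_inv d) (at (snd d q)))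
      (at (?T (snd c q)))" by (simp add: frechet_derivative_works Tz)
  moreover have "(?T has_derivative frechet_derivative ?T (at (snd c q))) (at (snd c q))"
    using dT by (simp add: frechet_derivative_works)
  ultimately have "((\<lambda>w. (f \<circ> chart_inv d) (?T w)) has_derivative
      (\<lambda>u. frechet_derivative (f \<circ> chart_inv d) (at (snd d q))
         (frechet_derivative ?T (at (snd c q)) u))) (at (snd c q))"
    using has_derivative_compose by blast
  then have "((f \<circ> chart_inv c) has_derivative
      (\<lambda>u. frechet_derivative (f \<circ> chart_inv d) (at (snd d q))
         (frechet_derivative ?T (at (snd c q)) u))) (at (snd c q))"
  proof (rule has_derivative_transform_within_open[OF _ W])
    fix w assume "w \<in> W"
    then show "(f \<circ> chart_inv d) (?T w) = (f \<circ> chart_inv c) w"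
      using chart_inv_snd[OF A cd(2)] inv[of w] by (simp add: transition_def)
  qed
  from fun_cong[OF frechet_derivative_at[OF this], of "X c"] show ?thesis
    using tangent_vector_transform[OF X cd q(2,3)] by simp
qed


section \<open>Sprays in coordinates\<close>

lemma spray_conical: "spray M A C G \<Longrightarrow> conical_region M A C"
  by (simp add: spray_def)

lemma spray_in_chart:
  assumes "smooth_atlas M A" "spray M A C G" "c \<in> tangent_atlas M A" "q \<in> C" "q \<in> fst c"
  shows "G q c = (snd (snd c q), (- 2) *\<^sub>R spray_coeffs G c (snd c q))"
proof -
  have "fst (G (chart_inv c (snd c q)) c) = snd (snd c q)"
    using assms snd_in_chart_image[OF assms(4,5)] unfolding spray_def by blast
  then show ?thesis
    by (simp add: spray_coeffs_def chart_inv_snd[OF assms(1,3,5)] prod_eq_iff)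
qed

lemma spray_coeffs_homogeneous:
  assumes "spray M A C G" "c \<in> tangent_atlas M A"
  shows "fiber_homogeneous 2 (chart_image C c) (\<lambda>z. spray_coeffs G c z $ r)"
  using assms by (simp add: spray_def fiber_homogeneous_def)

lemma Ck_on_spray_coeffs:
  assumes "smooth_atlas M A" "spray M A C G" "c \<in> tangent_atlas M A"
  shows "Ck_on k (chart_image C c) (\<lambda>z. spray_coeffs G c z)"
proof -
  have "Ck_on k (chart_image C c) (\<lambda>z. G (chart_inv c z) c)"
    using assms by (simp add: spray_def smooth_vector_field_def smooth_on_def)
  then show ?thesis
    unfolding spray_coeffs_def
    by (rule Ck_on_bounded_linear[OF
          bounded_linear_compose[OF bounded_linear_scaleR_right bounded_linear_snd]
          open_chart_image[OF assms(1) spray_conical[OF assms(2)] assms(3)]])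
qed

lemma Ck_on_spray_coeffs_component:
  assumes "smooth_atlas M A" "spray M A C G" "c \<in> tangent_atlas M A"
  shows "Ck_on k (chart_image C c) (\<lambda>z. spray_coeffs G c z $ r)"
  by (rule Ck_on_bounded_linear[OF bounded_linear_vec_nth
        open_chart_image[OF assms(1) spray_conical[OF assms(2)] assms(3)] Ck_on_spray_coeffs[OF assms]])

lemma hder0_eq_spray_derivative:
  assumes A: "smooth_atlas M A" and G: "spray M A C G" and c: "c \<in> tangent_atlas M A"
    and Q: "smooth_fun (tangent_atlas M A) C Q" and z: "z \<in> chart_image C c"
  shows "hder0 (spray_coeffs G c) (Q \<circ> chart_inv c) z =
    frechet_derivative (Q \<circ> chart_inv c) (at z) (snd z, (- 2) *\<^sub>R spray_coeffs G c z)"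
  by (rule hder0_eq_frechet_derivative[OF spray_coeffs_homogeneous[OF G c] _ _ z])
    (use Ck_on_differentiable[OF Ck_on_spray_coeffs_component[OF A G c] z]
      Ck_on_differentiable[OF smooth_fun_Ck_on[OF Q c, of "Suc 0"] z] in blast)+

lemma hamel_equation_chart_iff:
  assumes A: "smooth_atlas M A" and G: "spray M A C G" and c: "c \<in> tangent_atlas M A"
    and Q: "smooth_fun (tangent_atlas M A) C Q" and z: "z \<in> chart_image C c"
  shows "(\<forall>k. hder (spray_coeffs G c) k (Q \<circ> chart_inv c) z =
      vhder0 (spray_coeffs G c) k (Q \<circ> chart_inv c) z) \<longleftrightarrow>
    euler_lagrange (Q \<circ> chart_inv c) z (spray_coeffs G c z)"
  unfolding euler_lagrange_def
  using hamel_equation_iff[OF open_chart_image fiber_cone_chart_image spray_coeffs_homogeneous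
      Ck_on_spray_coeffs_component smooth_fun_Ck_on z,
      OF A spray_conical[OF G] c A spray_conical[OF G] c G c A G c Q c] by simp

lemma spray_coeffs_field_of_coeffs:
  assumes "smooth_atlas M A" "c \<in> tangent_atlas M A" "z \<in> chart_image C c"
  shows "spray_coeffs (field_of_coeffs (tangent_atlas M A) K) c z = K c z"
  using chart_imageE[OF assms] assms(2) by (simp add: spray_coeffs_def field_of_coeffs_def)

lemma spray_cong:
  fixes H H' :: "('m, 'n::finite) tfield"
  assumes A: "smooth_atlas M A" and H: "spray M A C H" and eq: "\<And>q. q \<in> C \<Longrightarrow> H q = H' q"
  shows "spray M A C H'"
proof -
  note C = spray_conical[OF H]
  have inv: "H' (chart_inv c z) = H (chart_inv c z)"
    if "c \<in> tangent_atlas M A" "z \<in> chart_image C c" for c z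
    using chart_imageE(1)[OF A that] eq by simp
  have co: "spray_coeffs H' c z = spray_coeffs H c z"
    if "c \<in> tangent_atlas M A" "z \<in> chart_image C c" for c z
    using inv[OF that] by (simp add: spray_coeffs_def)
  have sm: "smooth_on (chart_image C c) (\<lambda>z. H' (chart_inv c z) c)"
    if c: "c \<in> tangent_atlas M A" for c
    unfolding smooth_on_def
  proof
    fix k
    show "Ck_on k (chart_image C c) (\<lambda>z. H' (chart_inv c z) c)"
      by (rule Ck_on_cong[OF open_chart_image[OF A C c], of "\<lambda>z. H (chart_inv c z) c"])
        (use H c inv in \<open>auto simp: spray_def smooth_vector_field_def smooth_on_def\<close>)
  qed
  have cone: "(fst z, t *\<^sub>R snd z) \<in> chart_image C c"
    if "c \<in> tangent_atlas M A" "z \<in> chart_image C c" "t > 0" for c z t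
    using fiber_cone_chart_image[OF A C that(1)] that by (simp add: fiber_cone_def)
  have 1: "smooth_vector_field (tangent_atlas M A) C H'"
    using H sm eq by (simp add: spray_def smooth_vector_field_def)
  have 2: "fst (H' (chart_inv c z) c) = snd z \<and>
        (\<forall>t>0. spray_coeffs H' c (fst z, t *\<^sub>R snd z) = t\<^sup>2 *\<^sub>R spray_coeffs H' c z)"
    if cz: "c \<in> tangent_atlas M A" "z \<in> chart_image C c" for c z
    using H cz by (simp add: inv[OF cz] co[OF cz] co[OF cz(1) cone[OF cz]] spray_def)
  show ?thesis unfolding spray_def using C 1 2 by blast
qed

lemma projectively_related_cong:
  fixes H H' :: "('m, 'n::finite) tfield"
  assumes A: "smooth_atlas M A" and r: "projectively_related M A C G H"
    and eq: "\<And>q. q \<in> C \<Longrightarrow> H q = H' q"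
  shows "projectively_related M A C G H'"
proof -
  have H: "spray M A C H" using r by (simp add: projectively_related_def)
  have co: "spray_coeffs H' c z = spray_coeffs H c z"
    if "c \<in> tangent_atlas M A" "z \<in> chart_image C c" for c z
    using chart_imageE(1)[OF A that] eq by (simp add: spray_coeffs_def)
  show ?thesis
    using r spray_cong[OF A H eq] co by (simp add: projectively_related_def)
qed


section \<open>The Hamel spray\<close>

text \<open>The projective factor \<open>Q\<^sub>;\<^sub>0 / (2 Q)\<close> of the Hamel spray, seen in one chart.\<close>
definition hamel_factor ::
  "('m, 'n::finite) tfield \<Rightarrow> (('m, 'n) tpoint \<Rightarrow> real) \<Rightarrow> ('m, 'n) tchart \<Rightarrow>
    (real^'n) \<times> (real^'n) \<Rightarrow> real" where
  "hamel_factor G Q c z =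
     hder0 (spray_coeffs G c) (Q \<circ> chart_inv c) z / (2 * (Q \<circ> chart_inv c) z)"

lemma hamel_spray_alt:
  "hamel_spray M A G Q = field_of_coeffs (tangent_atlas M A)
     (\<lambda>c z. spray_coeffs G c z + hamel_factor G Q c z *\<^sub>R snd z)"
  by (simp add: hamel_spray_def hamel_factor_def)

lemma Ck_on_hamel_factor:
  fixes M :: "'m set" and A :: "('m, real^'n::finite) chart set"
  assumes A: "smooth_atlas M A" and G: "spray M A C G" and c: "c \<in> tangent_atlas M A"
    and Q: "smooth_fun (tangent_atlas M A) C Q" and nz: "\<And>q. q \<in> C \<Longrightarrow> Q q \<noteq> 0"
  shows "Ck_on k (chart_image C c) (hamel_factor G Q c)"
proof -
  let ?U = "chart_image C c" and ?f = "Q \<circ> chart_inv c"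
  have U: "open ?U" by (rule open_chart_image[OF A spray_conical[OF G] c])
  have f: "Ck_on j ?U ?f" for j by (rule smooth_fun_Ck_on[OF Q c])
  have y: "Ck_on k ?U (\<lambda>z. snd z $ i)" for i
    by (rule Ck_on_bounded_linear[OF bounded_linear_compose[OF bounded_linear_vec_nth
            bounded_linear_snd] U Ck_on_ident[OF U]])
  have g: "Ck_on k ?U (\<lambda>z. spray_coeffs G c z $ i)" for i
    by (rule Ck_on_spray_coeffs_component[OF A G c])
  have "Ck_on k ?U (\<lambda>z. ((\<Sum>i\<in>UNIV. snd z $ i * dx i ?f z) +
      (\<Sum>i\<in>UNIV. (- 2) * spray_coeffs G c z $ i * dy i ?f z)) * ((1/2) * inverse (?f z)))"
    by (intro Ck_on_mult Ck_on_add Ck_on_sum Ck_on_const Ck_on_inverse U y g f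
        Ck_on_dx[OF f] Ck_on_dy[OF f] finite) (use chart_imageE(1)[OF A c] nz in simp)
  then show ?thesis
  proof (rule Ck_on_cong[OF U, rotated])
    fix z assume z: "z \<in> ?U"
    show "((\<Sum>i\<in>UNIV. snd z $ i * dx i ?f z) +
        (\<Sum>i\<in>UNIV. (- 2) * spray_coeffs G c z $ i * dy i ?f z)) * ((1/2) * inverse (?f z)) =
        hamel_factor G Q c z"
      unfolding hamel_factor_def hder0_eq_spray_derivative[OF A G c Q z]
        frechet_derivative_coordinates[OF Ck_on_differentiable[OF f z]]
      by (simp add: field_simps)
  qed
qed

text \<open>At \<open>(x, t y)\<close> the spray is \<open>(t y, - 2 t\<^sup>2 G)\<close>, that is \<open>t\<close> times the fibrewise scaled value at
  \<open>(x, y)\<close>. Along it \<open>Q\<close> has derivative \<open>t\<^sup>2 Q\<^sub>;\<^sub>0\<close>, and division by \<open>2 Q\<close> removes one power of \<open>t\<close>.\<close>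
lemma fiber_homogeneous_hamel_factor:
  fixes M :: "'m set" and A :: "('m, real^'n::finite) chart set"
  assumes A: "smooth_atlas M A" and G: "spray M A C G" and c: "c \<in> tangent_atlas M A"
    and Q: "smooth_fun (tangent_atlas M A) C Q" and hom: "pos_homogeneous 1 C Q"
  shows "fiber_homogeneous 1 (chart_image C c) (hamel_factor G Q c)"
  unfolding fiber_homogeneous_def
proof (intro ballI allI impI)
  fix z :: "(real^'n) \<times> (real^'n)" and t :: real
  assume z: "z \<in> chart_image C c" and t: "0 < t"
  let ?U = "chart_image C c" and ?f = "Q \<circ> chart_inv c" and ?w = "(fst z, t *\<^sub>R snd z)"
  let ?G = "spray_coeffs G c"
  note C = spray_conical[OF G]
  have cone: "fiber_cone ?U" by (rule fiber_cone_chart_image[OF A C c])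
  have w: "?w \<in> ?U" using cone z t by (simp add: fiber_cone_def)
  have fh: "fiber_homogeneous 1 ?U ?f" by (rule fiber_homogeneous_chart_inv[OF A C c hom])
  have fd: "?f differentiable (at z)" if "z \<in> ?U" for z
    by (rule Ck_on_differentiable[OF smooth_fun_Ck_on[OF Q c, of "Suc 0"] that])
  have Gt: "?G ?w = t\<^sup>2 *\<^sub>R ?G z" using G c z t by (simp add: spray_def)
  have "hder0 ?G ?f ?w = frechet_derivative ?f (at ?w) (t *\<^sub>R snd z, (- 2) *\<^sub>R t\<^sup>2 *\<^sub>R ?G z)"
    using hder0_eq_spray_derivative[OF A G c Q w] Gt by simp
  also have "\<dots> = frechet_derivative ?f (at ?w) (t *\<^sub>R (snd z, t *\<^sub>R ((- 2) *\<^sub>R ?G z)))"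
    by (simp add: power2_eq_square algebra_simps)
  also have "\<dots> = t * frechet_derivative ?f (at ?w) (snd z, t *\<^sub>R ((- 2) *\<^sub>R ?G z))"
    by (simp only: linear_cmul[OF linear_frechet_derivative[OF fd[OF w]]] real_scaleR_def)
  also have "\<dots> = t * (t * hder0 ?G ?f z)"
    using frechet_derivative_homogeneous[OF open_chart_image[OF A C c] cone fh fd z t,
        of "snd z" "(- 2) *\<^sub>R ?G z"]
    by (simp add: hder0_eq_spray_derivative[OF A G c Q z])
  finally have "hder0 ?G ?f ?w = t * (t * hder0 ?G ?f z)" .
  moreover have "?f ?w = t * ?f z" using fh z t by (simp add: fiber_homogeneous_def)
  ultimately show "hamel_factor G Q c ?w = t ^ 1 * hamel_factor G Q c z"
    unfolding hamel_factor_def using t by simp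
qed

lemma hamel_factor_change_chart:
  fixes M :: "'m set" and A :: "('m, real^'n::finite) chart set"
  assumes A: "smooth_atlas M A" and G: "spray M A C G"
    and cd: "c \<in> tangent_atlas M A" "d \<in> tangent_atlas M A"
    and Q: "smooth_fun (tangent_atlas M A) C Q"
    and q: "q \<in> C" "q \<in> fst c" "q \<in> fst d"
  shows "hamel_factor G Q c (snd c q) = hamel_factor G Q d (snd d q)"
proof -
  have X: "G q \<in> tangent_space (tangent_atlas M A) q"
    using G q by (simp add: spray_def smooth_vector_field_def)
  have "hder0 (spray_coeffs G e) (Q \<circ> chart_inv e) (snd e q) =
      frechet_derivative (Q \<circ> chart_inv e) (at (snd e q)) (G q e)"
    if "e \<in> tangent_atlas M A" "q \<in> fst e" for e
    unfolding spray_in_chart[OF A G that(1) q(1) that(2)]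
    by (rule hder0_eq_spray_derivative[OF A G that(1) Q snd_in_chart_image[OF q(1) that(2)]])
  then show ?thesis
    using frechet_derivative_change_chart[OF A spray_conical[OF G] cd q Q X] cd q
    by (simp add: hamel_factor_def chart_inv_snd[OF A])
qed

text \<open>As a vector field, the Hamel spray is \<open>G\<close> plus a multiple of the Liouville field.\<close>
lemma hamel_spray_in_chart:
  assumes A: "smooth_atlas M A" and G: "spray M A C G" and c: "c \<in> tangent_atlas M A"
    and q: "q \<in> C" "q \<in> fst c"
  shows "hamel_spray M A G Q q c =
    G q c + (- 2 * hamel_factor G Q c (snd c q)) *\<^sub>R (0, snd (snd c q))"
  using c q by (simp add: hamel_spray_alt field_of_coeffs_def spray_in_chart[OF A G c q] algebra_simps)

lemma hamel_spray_projectively_related: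
  fixes M :: "'m set" and A :: "('m, real^'n::finite) chart set"
  assumes A: "smooth_atlas M A" and G: "spray M A C G"
    and Q: "smooth_fun (tangent_atlas M A) C Q" and hom: "pos_homogeneous 1 C Q"
    and nz: "\<And>q. q \<in> C \<Longrightarrow> Q q \<noteq> 0"
  shows "projectively_related M A C G (hamel_spray M A G Q)"
proof -
  let ?B = "tangent_atlas M A" and ?H = "hamel_spray M A G Q" and ?p = "hamel_factor G Q"
  note C = spray_conical[OF G]
  have co: "spray_coeffs ?H c z = spray_coeffs G c z + ?p c z *\<^sub>R snd z"
    if "c \<in> ?B" "z \<in> chart_image C c" for c z
    unfolding hamel_spray_alt by (rule spray_coeffs_field_of_coeffs[OF A that])
  have tangent: "?H q \<in> tangent_space ?B q" if q: "q \<in> C" for q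
    unfolding tangent_space_def
  proof (intro CollectI conjI allI impI ballI)
    fix c assume "c \<notin> ?B \<or> q \<notin> fst c"
    then show "?H q c = 0" by (auto simp: hamel_spray_def field_of_coeffs_def)
  next
    fix c d assume c: "c \<in> ?B" and d: "d \<in> ?B" and qcd: "q \<in> fst c \<and> q \<in> fst d"
    have X: "G q \<in> tangent_space ?B q" using G q by (simp add: spray_def smooth_vector_field_def)
    let ?l = "frechet_derivative (transition c d) (at (snd c q))"
    have "transition c d differentiable (at (snd c q)) \<and> ?l (0, snd (snd c q)) = (0, snd (snd d q))"
      by (rule tangent_transition[OF A C c d q conjunct1[OF qcd] conjunct2[OF qcd]], rule conjI)
    then have lin: "linear ?l" and l: "?l (0, snd (snd c q)) = (0, snd (snd d q))"
      by (auto intro: linear_frechet_derivative)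
    have "?l (?H q c) = ?l (G q c) + (- 2 * ?p c (snd c q)) *\<^sub>R ?l (0, snd (snd c q))"
      using qcd by (simp only: hamel_spray_in_chart[OF A G c q] linear_add[OF lin] linear_cmul[OF lin])
    also have "\<dots> = G q d + (- 2 * ?p d (snd d q)) *\<^sub>R (0, snd (snd d q))"
      using hamel_factor_change_chart[OF A G c d Q q] tangent_vector_transform[OF X c d] qcd
      by (simp add: l)
    finally show "?H q d = ?l (?H q c)"
      using qcd by (simp only: hamel_spray_in_chart[OF A G d q])
  qed
  have smooth: "smooth_on (chart_image C c) (\<lambda>z. ?H (chart_inv c z) c)" if c: "c \<in> ?B" for c
    unfolding smooth_on_def
  proof
    fix k
    have U: "open (chart_image C c)" by (rule open_chart_image[OF A C c])
    have y: "Ck_on k (chart_image C c) (\<lambda>z. snd z)"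
      by (rule Ck_on_bounded_linear[OF bounded_linear_snd U Ck_on_ident[OF U]])
    have "Ck_on k (chart_image C c)
        (\<lambda>z. (snd z, (- 2) *\<^sub>R (spray_coeffs G c z + ?p c z *\<^sub>R snd z)))"
      by (intro Ck_on_Pair Ck_on_scaleR Ck_on_add Ck_on_const U y Ck_on_spray_coeffs[OF A G c]
          Ck_on_hamel_factor[OF A G c Q nz])
    then show "Ck_on k (chart_image C c) (\<lambda>z. ?H (chart_inv c z) c)"
      by (rule Ck_on_cong[OF U, rotated])
        (use c chart_imageE[OF A c] in \<open>simp add: hamel_spray_alt field_of_coeffs_def\<close>)
  qed
  have local: "fst (?H (chart_inv c z) c) = snd z \<and>
      (\<forall>t>0. spray_coeffs ?H c (fst z, t *\<^sub>R snd z) = t\<^sup>2 *\<^sub>R spray_coeffs ?H c z)"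
    if c: "c \<in> ?B" and z: "z \<in> chart_image C c" for c z
  proof (intro conjI allI impI)
    show "fst (?H (chart_inv c z) c) = snd z"
      using chart_imageE[OF A c z] c by (simp add: hamel_spray_alt field_of_coeffs_def)
    fix t :: real assume t: "0 < t"
    have w: "(fst z, t *\<^sub>R snd z) \<in> chart_image C c"
      using fiber_cone_chart_image[OF A C c] z t by (simp add: fiber_cone_def)
    have "?p c (fst z, t *\<^sub>R snd z) = t * ?p c z"
      using fiber_homogeneous_hamel_factor[OF A G c Q hom] z t by (simp add: fiber_homogeneous_def)
    moreover have "spray_coeffs G c (fst z, t *\<^sub>R snd z) = t\<^sup>2 *\<^sub>R spray_coeffs G c z"
      using G c z t by (simp add: spray_def)
    ultimately show "spray_coeffs ?H c (fst z, t *\<^sub>R snd z) = t\<^sup>2 *\<^sub>R spray_coeffs ?H c z"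
      by (simp add: co[OF c z] co[OF c w] scaleR_add_right power2_eq_square)
  qed
  have H: "spray M A C ?H"
    unfolding spray_def smooth_vector_field_def using C tangent smooth local by blast
  \<comment> \<open>The factors in the charts agree on overlaps, so any choice of chart yields the global factor.\<close>
  define P where "P q = (let c = (SOME c. c \<in> ?B \<and> q \<in> fst c) in ?p c (snd c q))" for q
  have P: "P q = ?p c (snd c q)" if "c \<in> ?B" "q \<in> C" "q \<in> fst c" for c q
  proof -
    have "(SOME c. c \<in> ?B \<and> q \<in> fst c) \<in> ?B \<and> q \<in> fst (SOME c. c \<in> ?B \<and> q \<in> fst c)"
      by (rule someI[of _ c]) (use that in simp)
    then show ?thesis
      unfolding P_def Let_def using hamel_factor_change_chart[OF A G _ that(1) Q that(2) _ that(3)]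
      by blast
  qed
  have "pos_homogeneous 1 C P"
    unfolding pos_homogeneous_def
  proof (intro ballI allI impI)
    fix q and t :: real assume q: "q \<in> C" and t: "0 < t"
    have qT: "q \<in> tangent_bundle M A" using q conical_region_openin[OF A C] by blast
    have "(\<Union>a\<in>A. fst a) = M" using A by (simp add: smooth_atlas_def)
    moreover have "fst q \<in> M" using qT by (auto simp: tangent_bundle_def)
    ultimately obtain a where a: "a \<in> A" "fst q \<in> fst a" by blast
    obtain c where c: "c \<in> ?B" "q \<in> fst c"
    proof
      show "tangent_chart M A a \<in> ?B" using a(1) by (simp add: tangent_atlas_def)
      show "q \<in> fst (tangent_chart M A a)" using a(2) qT by (simp add: tangent_chart_def)
    qed
    note s = tangent_chart_scale_vec[OF A C c(1) q c(2) t]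
    show "P (scale_vec t q) = t ^ 1 * P q"
      using fiber_homogeneous_hamel_factor[OF A G c(1) Q hom] snd_in_chart_image[OF q c(2)] t
      by (simp add: P[OF c(1) s(1,2)] P[OF c(1) q c(2)] s(3) fiber_homogeneous_def)
  qed
  moreover have "spray_coeffs ?H c z = spray_coeffs G c z + P (chart_inv c z) *\<^sub>R snd z"
    if "c \<in> ?B" "z \<in> chart_image C c" for c z
    using co[OF that] P[OF that(1) chart_imageE(1,2)[OF A that]] chart_imageE(3)[OF A that] by simp
  ultimately show ?thesis using G H unfolding projectively_related_def by blast
qed


section \<open>Metrizability and Finsler-Hamel functions\<close>

lemma fundamental_tensor_scale:
  fixes L L' :: "(real^'n::finite) \<times> (real^'n) \<Rightarrow> real"
  assumes V: "open V" "z \<in> V" and CL: "Ck_on 2 V L"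
    and eq: "\<And>w. w \<in> V \<Longrightarrow> L' w = c * L w"
  shows "fundamental_tensor L' z = c *\<^sub>R fundamental_tensor L z"
proof -
  have half: "Ck_on (Suc (Suc 0)) V (\<lambda>w. 1/2 * L w)"
    using Ck_on_mult[OF V(1) Ck_on_const[OF V(1)] CL, of "1/2"] by (simp add: numeral_2_eq_2)
  have d1: "dy i (\<lambda>w. 1/2 * L' w) w = c * dy i (\<lambda>w. 1/2 * L w) w" if w: "w \<in> V" for i w
  proof -
    have "((\<lambda>w. 1/2 * L' w) has_derivative
        (\<lambda>u. c * frechet_derivative (\<lambda>w. 1/2 * L w) (at w) u)) (at w)"
      by (rule has_derivative_transform_within_open[OF
            has_derivative_mult_right[OF Ck_on_has_derivative[OF half w]] V(1) w]) (simp add: eq)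
    from fun_cong[OF frechet_derivative_at[OF this], of "(0, axis i 1)"] show ?thesis
      by (simp only: dy_def)
  qed
  have "dy j (dy i (\<lambda>w. 1/2 * L' w)) z = c * dy j (dy i (\<lambda>w. 1/2 * L w)) z" for i j
  proof -
    have "(dy i (\<lambda>w. 1/2 * L' w) has_derivative
        (\<lambda>u. c * frechet_derivative (dy i (\<lambda>w. 1/2 * L w)) (at z) u)) (at z)"
      by (rule has_derivative_transform_within_open[OF
            has_derivative_mult_right[OF Ck_on_has_derivative[OF Ck_on_dy[OF half] V(2)]] V])
        (rule d1[symmetric])
    from fun_cong[OF frechet_derivative_at[OF this], of "(0, axis j 1)"] show ?thesis
      unfolding dy_def[of j] by simp
  qed
  then show ?thesis unfolding fundamental_tensor_def vec_eq_iff by simp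
qed

lemma invertible_scaleR:
  fixes A :: "real^'n::finite^'n"
  assumes "invertible A" "c \<noteq> 0"
  shows "invertible (c *\<^sub>R A)"
proof -
  obtain B where "A ** B = mat 1" "B ** A = mat 1" using assms by (auto simp: invertible_def)
  then show ?thesis
    unfolding invertible_def using assms(2)
    by (intro exI[of _ "inverse c *\<^sub>R B"])
      (simp add: scalar_matrix_assoc[symmetric] matrix_scalar_ac)
qed

text \<open>A metric may be negative and may change sign between components of the conical region. By
  continuity its sign is locally constant, so the constant \<open>c\<close> of \<open>euler_lagrange_square_iff\<close> can
  be taken to be the sign at the point.\<close>
lemma sqrt_abs_local_square:
  fixes L :: "'a::topological_space \<Rightarrow> real"
  assumes "open U" "continuous_on U L" "z \<in> U" "L z \<noteq> 0"
  shows "\<exists>V. open V \<and> V \<subseteq> U \<and> z \<in> V \<and> (\<forall>w\<in>V. L w = sgn (L z) * (sqrt \<bar>L w\<bar>)\<^sup>2)"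
proof (intro exI conjI ballI)
  let ?V = "U \<inter> (\<lambda>w. sgn (L z) * L w) -` {0<..}"
  show "open ?V"
    by (rule continuous_open_preimage) (use assms in \<open>auto intro!: continuous_intros\<close>)
  show "z \<in> ?V" using assms by (auto simp: sgn_if)
  show "L w = sgn (L z) * (sqrt \<bar>L w\<bar>)\<^sup>2" if "w \<in> ?V" for w
    using that assms(4) by (auto simp: sgn_if split: if_splits)
qed auto

text \<open>\<open>L\<close> satisfies the Euler-Lagrange equation for its own spray. This passes to \<open>\<surd>\<bar>L\<bar>\<close> by the square
  law and to \<open>G\<close> by projective invariance.\<close>
lemma finsler_hamel_function_sqrt_metric:
  fixes M :: "'m set" and A :: "('m, real^'n::finite) chart set"
  assumes A: "smooth_atlas M A" and G: "spray M A C G"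
    and L: "finsler_metric M A C L" and r: "projectively_related M A C G (finsler_spray M A L)"
  shows "finsler_hamel_function M A C G (\<lambda>q. sqrt \<bar>L q\<bar>)"
proof -
  let ?B = "tangent_atlas M A" and ?F = "\<lambda>q. sqrt \<bar>L q\<bar>"
  note C = spray_conical[OF G]
  have nz: "L q \<noteq> 0" if "q \<in> C" for q using L that by (simp add: finsler_metric_def)
  have Ls: "smooth_fun ?B C L" and Lh: "pos_homogeneous 2 C L" using L by (auto simp: finsler_metric_def)
  have CL: "Ck_on k (chart_image C c) (L \<circ> chart_inv c)" if "c \<in> ?B" for c k
    by (rule smooth_fun_Ck_on[OF Ls that])
  have CF: "Ck_on k (chart_image C c) (?F \<circ> chart_inv c)" if c: "c \<in> ?B" for c k
    using Ck_on_sqrt_abs[OF open_chart_image[OF A C c] CL[OF c]] nz chart_imageE(1)[OF A c]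
    by (simp add: comp_def)
  have Fs: "smooth_fun ?B C ?F" using CF by (simp add: smooth_fun_def smooth_on_def)
  have Fh: "pos_homogeneous 1 C ?F"
    using Lh by (simp add: pos_homogeneous_def abs_mult real_sqrt_mult)
  have localsq: "\<exists>V. open V \<and> V \<subseteq> chart_image C c \<and> z \<in> V \<and>
      (\<forall>w\<in>V. (L \<circ> chart_inv c) w = sgn ((L \<circ> chart_inv c) z) * ((?F \<circ> chart_inv c) w)\<^sup>2)"
    if c: "c \<in> ?B" and z: "z \<in> chart_image C c" for c z
  proof -
    have "continuous_on (chart_image C c) (L \<circ> chart_inv c)" using CL[OF c, of 0] by simp
    moreover have "(L \<circ> chart_inv c) z \<noteq> 0" using nz chart_imageE(1)[OF A c z] by simp
    ultimately show ?thesis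
      using sqrt_abs_local_square[OF open_chart_image[OF A C c] _ z, of "L \<circ> chart_inv c"] by simp
  qed
  have inv: "invertible (fundamental_tensor ((\<lambda>q. (?F q)\<^sup>2) \<circ> chart_inv c) z)"
    if c: "c \<in> ?B" and z: "z \<in> chart_image C c" for c z
  proof -
    let ?s = "sgn ((L \<circ> chart_inv c) z)"
    obtain V where V: "open V" "V \<subseteq> chart_image C c" "z \<in> V"
      and eq: "\<And>w. w \<in> V \<Longrightarrow> (L \<circ> chart_inv c) w = ?s * ((?F \<circ> chart_inv c) w)\<^sup>2"
      using localsq[OF c z] by blast
    have s: "?s \<noteq> 0" "?s * ?s = 1"
      using nz chart_imageE(1)[OF A c z] by (auto simp: sgn_if)
    have "Ck_on 2 V (L \<circ> chart_inv c)" by (rule Ck_on_subset[OF CL[OF c] V(2)])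
    moreover have "((\<lambda>q. (?F q)\<^sup>2) \<circ> chart_inv c) w = ?s * (L \<circ> chart_inv c) w" if "w \<in> V" for w
      unfolding eq[OF that] using s(2) by (simp add: mult.assoc[symmetric])
    ultimately have "fundamental_tensor ((\<lambda>q. (?F q)\<^sup>2) \<circ> chart_inv c) z =
        ?s *\<^sub>R fundamental_tensor (L \<circ> chart_inv c) z"
      by (rule fundamental_tensor_scale[OF V(1,3)])
    moreover have "invertible (fundamental_tensor (L \<circ> chart_inv c) z)"
      using L c z by (simp add: finsler_metric_def)
    ultimately show ?thesis using s(1) invertible_scaleR by simp
  qed
  have "smooth_fun ?B C (\<lambda>q. (?F q)\<^sup>2)"
    unfolding smooth_fun_def smooth_on_def
  proof (intro ballI allI)
    fix c k assume c: "c \<in> ?B"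
    show "Ck_on k (chart_image C c) ((\<lambda>q. (?F q)\<^sup>2) \<circ> chart_inv c)"
      using Ck_on_mult[OF open_chart_image[OF A C c] CF[OF c] CF[OF c]]
      by (simp only: comp_def power2_eq_square)
  qed
  moreover have "pos_homogeneous 2 C (\<lambda>q. (?F q)\<^sup>2)"
    using Lh by (simp add: pos_homogeneous_def abs_mult)
  ultimately have "finsler_metric1 M A C ?F"
    using C Fs Fh inv nz unfolding finsler_metric1_def finsler_metric_def by simp
  moreover have "euler_lagrange (?F \<circ> chart_inv c) z (spray_coeffs G c z)"
    if c: "c \<in> ?B" and z: "z \<in> chart_image C c" for c z
  proof -
    let ?U = "chart_image C c" and ?f = "?F \<circ> chart_inv c" and ?L = "L \<circ> chart_inv c"
    have U: "open ?U" "fiber_cone ?U"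
      by (rule open_chart_image[OF A C c], rule fiber_cone_chart_image[OF A C c])
    have fh: "fiber_homogeneous 1 ?U ?f" by (rule fiber_homogeneous_chart_inv[OF A C c Fh])
    obtain V where V: "open V" "V \<subseteq> ?U" "z \<in> V"
      and eq: "\<And>w. w \<in> V \<Longrightarrow> ?L w = sgn (?L z) * (?f w)\<^sup>2"
      using localsq[OF c z] by blast
    have n: "sgn (?L z) \<noteq> 0" "?f z \<noteq> 0"
      using nz chart_imageE(1)[OF A c z] by (auto simp: sgn_if)
    have i: "invertible (fundamental_tensor ?L z)" using L c z by (simp add: finsler_metric_def)
    have "euler_lagrange ?L z (finsler_coeffs ?L z)"
      using euler_lagrange_iff_finsler_coeffs[OF U(1) CL[OF c] z i] by blast
    then have "euler_lagrange ?f z (finsler_coeffs ?L z)"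
      using euler_lagrange_square_iff[OF U(1) fh CF[OF c] V eq n] by blast
    moreover obtain P where "spray_coeffs (finsler_spray M A L) c z =
        spray_coeffs G c z + P (chart_inv c z) *\<^sub>R snd z"
      using r c z unfolding projectively_related_def by blast
    then have "finsler_coeffs ?L z = spray_coeffs G c z + P (chart_inv c z) *\<^sub>R snd z"
      unfolding finsler_spray_def by (simp add: spray_coeffs_field_of_coeffs[OF A c z])
    ultimately show ?thesis
      using euler_lagrange_projective[OF U fh CF[OF c] z] by simp
  qed
  then have "hamel_function M A C G ?F"
    unfolding hamel_function_def
    using Fs Fh hamel_equation_chart_iff[OF A G _ Fs] by blast
  ultimately show ?thesis by (simp add: finsler_hamel_function_def)
qed

text \<open>\<open>F\<close> satisfies the Euler-Lagrange equation for \<open>G\<close>, hence for \<open>G + p y\<close> with any \<open>p\<close>. The energy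
  condition for \<open>G + p y\<close> is \<open>F\<^sub>;\<^sub>0 - 2 p F = 0\<close>, which singles out the Hamel factor. Then \<open>F\<^sup>2\<close> solves
  the Euler-Lagrange equation as well, and nondegeneracy identifies \<open>G + p y\<close> with its spray.\<close>
lemma finsler_spray_eq_hamel_spray:
  fixes M :: "'m set" and A :: "('m, real^'n::finite) chart set"
  assumes A: "smooth_atlas M A" and G: "spray M A C G"
    and F: "finsler_hamel_function M A C G F" and q: "q \<in> C"
  shows "finsler_spray M A (\<lambda>q. (F q)\<^sup>2) q = hamel_spray M A G F q"
proof
  fix c :: "('m, 'n) tchart"
  let ?B = "tangent_atlas M A" and ?L = "(\<lambda>q. (F q)\<^sup>2) \<circ> chart_inv c" and ?f = "F \<circ> chart_inv c"
  note C = spray_conical[OF G]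
  show "finsler_spray M A (\<lambda>q. (F q)\<^sup>2) q c = hamel_spray M A G F q c"
  proof (cases "c \<in> ?B \<and> q \<in> fst c")
    case False
    then show ?thesis by (auto simp: finsler_spray_def hamel_spray_def field_of_coeffs_def)
  next
    case True
    then have c: "c \<in> ?B" and qc: "q \<in> fst c" by auto
    let ?U = "chart_image C c" and ?z = "snd c q"
    let ?g = "spray_coeffs G c ?z" and ?p = "hamel_factor G F c ?z"
    have z: "?z \<in> ?U" by (rule snd_in_chart_image[OF q qc])
    have U: "open ?U" "fiber_cone ?U"
      by (rule open_chart_image[OF A C c], rule fiber_cone_chart_image[OF A C c])
    have Fs: "smooth_fun ?B C F" and Fh: "pos_homogeneous 1 C F"
      and F2: "finsler_metric M A C (\<lambda>q. (F q)\<^sup>2)"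
      using F by (auto simp: finsler_hamel_function_def finsler_metric1_def)
    have fh: "fiber_homogeneous 1 ?U ?f" by (rule fiber_homogeneous_chart_inv[OF A C c Fh])
    have Cf: "Ck_on k ?U ?f" for k by (rule smooth_fun_Ck_on[OF Fs c])
    have CL: "Ck_on 2 ?U ?L" by (rule smooth_fun_Ck_on[OF _ c]) (use F2 in \<open>simp add: finsler_metric_def\<close>)
    have fz: "?f ?z \<noteq> 0" using F2 q chart_inv_snd[OF A c qc] by (simp add: finsler_metric_def)
    have i: "invertible (fundamental_tensor ?L ?z)" using F2 c z by (simp add: finsler_metric_def)
    have "euler_lagrange ?f ?z ?g"
      using F c z hamel_equation_chart_iff[OF A G c Fs z]
      by (simp add: finsler_hamel_function_def hamel_function_def)
    then have EL: "euler_lagrange ?f ?z (?g + ?p *\<^sub>R snd ?z)"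
      using euler_lagrange_projective[OF U fh Cf z] by simp
    let ?l = "frechet_derivative ?f (at ?z)"
    have d: "?f differentiable (at ?z)" by (rule Ck_on_differentiable[OF Cf z])
    have l: "linear ?l" by (rule linear_frechet_derivative[OF d])
    have "?l (snd ?z, (- 2) *\<^sub>R (?g + ?p *\<^sub>R snd ?z)) =
        ?l ((snd ?z, (- 2) *\<^sub>R ?g) + (- 2 * ?p) *\<^sub>R (0, snd ?z))"
      by (simp add: algebra_simps)
    also have "\<dots> = ?l (snd ?z, (- 2) *\<^sub>R ?g) + (- 2 * ?p) * ?l (0, snd ?z)"
      by (simp only: linear_add[OF l] linear_cmul[OF l] real_scaleR_def)
    also have "?l (0, snd ?z) = ?f ?z" using euler_homogeneous[OF fh z d] by simp
    also have "?l (snd ?z, (- 2) *\<^sub>R ?g) = 2 * ?f ?z * ?p"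
      using hder0_eq_spray_derivative[OF A G c Fs z] fz by (simp add: hamel_factor_def)
    also have "2 * ?f ?z * ?p + (- 2 * ?p) * ?f ?z = 0" by simp
    finally have "?l (snd ?z, (- 2) *\<^sub>R (?g + ?p *\<^sub>R snd ?z)) = 0" .
    moreover have "?L w = 1 * (?f w)\<^sup>2" for w by simp
    ultimately have "euler_lagrange ?L ?z (?g + ?p *\<^sub>R snd ?z)"
      using euler_lagrange_square_iff[OF U(1) fh Cf U(1) subset_refl z _ one_neq_zero fz] EL by blast
    then have "?g + ?p *\<^sub>R snd ?z = finsler_coeffs ?L ?z"
      using euler_lagrange_iff_finsler_coeffs[OF U(1) CL z i] by blast
    then show ?thesis
      using True by (simp add: finsler_spray_def hamel_spray_alt field_of_coeffs_def)
  qed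
qed

theorem theorem1p3:
  fixes M :: "'m set"
    and A :: "('m, real^'n::finite) chart set"
    and C :: "('m, 'n) tpoint set"
    and G :: "('m, 'n) tfield"
  assumes "smooth_manifold M A"
    and "spray M A C G"
  shows "(projectively_metrizable M A C G \<longleftrightarrow> (\<exists>F. finsler_hamel_function M A C G F)) \<and>
         (\<forall>F. finsler_hamel_function M A C G F \<longrightarrow>
            projectively_related M A C G (finsler_spray M A (\<lambda>q. (F q)\<^sup>2)) \<and>
            (\<forall>q\<in>C. finsler_spray M A (\<lambda>q. (F q)\<^sup>2) q = hamel_spray M A G F q))"
proof -
  have A: "smooth_atlas M A" using assms(1) by (simp add: smooth_manifold_def)
  note G = assms(2)
  have eq: "finsler_spray M A (\<lambda>q. (F q)\<^sup>2) q = hamel_spray M A G F q"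
    if "finsler_hamel_function M A C G F" "q \<in> C" for F q
    by (rule finsler_spray_eq_hamel_spray[OF A G that])
  have rel: "projectively_related M A C G (finsler_spray M A (\<lambda>q. (F q)\<^sup>2))"
    if F: "finsler_hamel_function M A C G F" for F
  proof (rule projectively_related_cong[OF A hamel_spray_projectively_related[OF A G]])
    show "smooth_fun (tangent_atlas M A) C F" "pos_homogeneous 1 C F"
      using F by (auto simp: finsler_hamel_function_def finsler_metric1_def)
    show "F q \<noteq> 0" if "q \<in> C" for q
      using F that by (auto simp: finsler_hamel_function_def finsler_metric1_def finsler_metric_def)
  qed (simp add: eq[OF F])
  have "finsler_metric M A C (\<lambda>q. (F q)\<^sup>2)" if "finsler_hamel_function M A C G F" for F
    using that by (simp add: finsler_hamel_function_def finsler_metric1_def)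
  then have "projectively_metrizable M A C G \<longleftrightarrow> (\<exists>F. finsler_hamel_function M A C G F)"
    unfolding projectively_metrizable_def
    using finsler_hamel_function_sqrt_metric[OF A G] rel by blast
  then show ?thesis using rel eq by blast
qed

end
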